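(* Let $\mathcal F$ be a saturated fusion system on a finite abelian $2$-group $S$. Then $\dim_{\mathbb F_2}B(\mathcal F)^\times=s+1$, where $s$ is the number of $\mathcal F$-conjugacy classes of maximal subgroups of $S$.
   Context: Burnside rings: for a finite group $G$, $B(G)$ is the Grothendieck ring of finite left $G$-sets, with addition $[X]+[Y]=[X\sqcup Y]$ and multiplication $[X][Y]=[X\times Y]$. For $H\leq G$, the map $[X]\mapsto|X^H|$ extends to a ring morphism $B(G)\to\mathbb Z$, written $a\mapsto|a^H|$; the map $a\mapsto(|a^H|)_{H\leq G}$ is injective. Fusion systems: a fusion system $\mathcal F$ on a finite $p$-group $S$ is a category whose objects are the subgroups of $S$ and whose morphisms are injective group homomorphisms, such that for $P,Q\leq S$ one has $\mathrm{Hom}_S(P,Q)\subseteq\mathrm{Hom}_{\mathcal F}(P,Q)$ (where $\mathrm{Hom}_S(P,Q)$ is the set of homomorphisms given by conjugation by an element of $S$), and every $\varphi\in\mathrm{Hom}_{\mathcal F}(P,Q)$ is the composition of an isomorphism in $\mathcal F$ and an inclusion of subgroups. Subgroups $P,Q$ are $\mathcal F$-conjugate if they are isomorphic in $\mathcal F$. Put $\mathrm{Aut}_{\mathcal F}(P)=\mathrm{Hom}_{\mathcal F}(P,P)$ and $\mathrm{Aut}_S(P)=\mathrm{Hom}_S(P,P)$. $P$ is fully $\mathcal F$-automized if $\mathrm{Aut}_S(P)\in\mathrm{Syl}_p(\mathrm{Aut}_{\mathcal F}(P))$, and receptive if every isomorphism $\varphi:Q\to P$ in $\mathcal F$ extends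 to a morphism in $\mathcal F$ defined on $N_\varphi=\{g\in N_S(Q):\varphi c_g\varphi^{-1}\in\mathrm{Aut}_S(P)\}$, where $c_g$ is conjugation by $g$. $\mathcal F$ is saturated if every subgroup of $S$ is $\mathcal F$-conjugate to one that is fully $\mathcal F$-automized and receptive. The Burnside ring of $\mathcal F$ is the subring $B(\mathcal F)=\{a\in B(S): |a^P|=|a^Q|\text{ whenever }P,Q\leq S\text{ are }\mathcal F\text{-conjugate}\}$. Its unit group $B(\mathcal F)^\times$ is a finite elementary abelian $2$-group (a subgroup of $B(S)^\times$), regarded as an $\mathbb F_2$-vector space. *)

theory Defs
  imports
    "HOL-Algebra.Group_Action"
    "HOL-Number_Theory.Residues"
    "HOL-Library.Nat_Bijection"
    "Jordan_Normal_Form.Missing_VectorSpace"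
begin

section \<open>Finite \<open>G\<close>-sets\<close>

text \<open>
  A \<open>G\<close>-set is a carrier together with an action, as in \<^locale>\<open>group_action\<close>.  Carriers are sets of
  natural numbers: every finite \<open>G\<close>-set is isomorphic to one of this kind, so nothing is lost, and the
  finite \<open>G\<close>-sets form a set closed under (encoded) disjoint union and product.
\<close>

type_synonym 'g gset = "nat set \<times> ('g \<Rightarrow> nat \<Rightarrow> nat)"

definition fin_gsets :: "('g, 'm) monoid_scheme \<Rightarrow> 'g gset set" where
  "fin_gsets G = {(E, \<phi>). finite E \<and> group_action G E \<phi>}"

definition gset_iso :: "('g, 'm) monoid_scheme \<Rightarrow> 'g gset \<Rightarrow> 'g gset \<Rightarrow> bool" where
  "gset_iso G X Y \<longleftrightarrow>
     (\<exists>f. bij_betw f (fst X) (fst Y) \<and>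
          (\<forall>g \<in> carrier G. \<forall>x \<in> fst X. f (snd X g x) = snd Y g (f x)))"

definition gset_sum :: "'g gset \<Rightarrow> 'g gset \<Rightarrow> 'g gset" where
  "gset_sum X Y =
     (let E = sum_encode ` (fst X <+> fst Y)
      in (E, \<lambda>g. \<lambda>n \<in> E. sum_encode (map_sum (snd X g) (snd Y g) (sum_decode n))))"

definition gset_prod :: "'g gset \<Rightarrow> 'g gset \<Rightarrow> 'g gset" where
  "gset_prod X Y =
     (let E = prod_encode ` (fst X \<times> fst Y)
      in (E, \<lambda>g. \<lambda>n \<in> E. prod_encode (map_prod (snd X g) (snd Y g) (prod_decode n))))"

definition gset_empty :: "'g gset" where
  "gset_empty = ({}, \<lambda>g. \<lambda>n \<in> {}. n)"

definition gset_point :: "'g gset" where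
  "gset_point = ({0}, \<lambda>g. \<lambda>n \<in> {0}. n)"

definition gset_fixed :: "'g gset \<Rightarrow> 'g set \<Rightarrow> nat set" where
  "gset_fixed X H = {x \<in> fst X. \<forall>h \<in> H. snd X h x = x}"

section \<open>The Burnside ring of a group\<close>

text \<open>
  Grothendieck construction: the class of \<open>(X, Y)\<close> is the virtual \<open>G\<close>-set \<open>[X] - [Y]\<close>.
\<close>

definition burnside_rel :: "('g, 'm) monoid_scheme \<Rightarrow> (('g gset \<times> 'g gset) \<times> ('g gset \<times> 'g gset)) set" where
  "burnside_rel G =
     {((X, Y), (X', Y')).
        X \<in> fin_gsets G \<and> Y \<in> fin_gsets G \<and> X' \<in> fin_gsets G \<and> Y' \<in> fin_gsets G \<and>
        (\<exists>Z \<in> fin_gsets G.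
           gset_iso G (gset_sum (gset_sum X Y') Z) (gset_sum (gset_sum X' Y) Z))}"

definition virtual_add :: "'g gset \<times> 'g gset \<Rightarrow> 'g gset \<times> 'g gset \<Rightarrow> 'g gset \<times> 'g gset" where
  "virtual_add u v = (gset_sum (fst u) (fst v), gset_sum (snd u) (snd v))"

definition virtual_mult :: "'g gset \<times> 'g gset \<Rightarrow> 'g gset \<times> 'g gset \<Rightarrow> 'g gset \<times> 'g gset" where
  "virtual_mult u v =
     (gset_sum (gset_prod (fst u) (fst v)) (gset_prod (snd u) (snd v)),
      gset_sum (gset_prod (fst u) (snd v)) (gset_prod (snd u) (fst v)))"

definition burnside_ring :: "('g, 'm) monoid_scheme \<Rightarrow> ('g gset \<times> 'g gset) set ring" where
  "burnside_ring G =
     \<lparr>carrier = (fin_gsets G \<times> fin_gsets G) // burnside_rel G,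
      monoid.mult = \<lambda>a b. \<Union>u \<in> a. \<Union>v \<in> b. burnside_rel G `` {virtual_mult u v},
      one = burnside_rel G `` {(gset_point, gset_empty)},
      zero = burnside_rel G `` {(gset_empty, gset_empty)},
      add = \<lambda>a b. \<Union>u \<in> a. \<Union>v \<in> b. burnside_rel G `` {virtual_add u v}\<rparr>"

text \<open>
  The mark \<open>|a\<^sup>H|\<close>.  For \<open>a\<close> in the Burnside ring and a subgroup \<open>H\<close>, all representatives \<open>(X, Y)\<close> of
  \<open>a\<close> give the same integer, so the image below is a singleton.
\<close>

definition burnside_mark :: "('g gset \<times> 'g gset) set \<Rightarrow> 'g set \<Rightarrow> int" where
  "burnside_mark a H =
     the_elem ((\<lambda>(X, Y). int (card (gset_fixed X H)) - int (card (gset_fixed Y H))) ` a)"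

section \<open>Fusion systems\<close>

text \<open>
  A fusion system is given by its hom-sets: \<open>F P Q\<close> is the set of morphisms from \<open>P\<close> to \<open>Q\<close>, for
  subgroups \<open>P\<close> and \<open>Q\<close> of \<open>S\<close> (its values on other sets play no role).  So that equality of morphisms
  is equality of functions, morphisms are extensional on their domain, and they are composed with
  \<^const>\<open>compose\<close>.
\<close>

definition conj_hom :: "('a, 'm) monoid_scheme \<Rightarrow> 'a set \<Rightarrow> 'a set \<Rightarrow> ('a \<Rightarrow> 'a) set" where
  "conj_hom S P Q =
     {(\<lambda>x \<in> P. g \<otimes>\<^bsub>S\<^esub> x \<otimes>\<^bsub>S\<^esub> inv\<^bsub>S\<^esub> g) |g.
        g \<in> carrier S \<and> (\<forall>x \<in> P. g \<otimes>\<^bsub>S\<^esub> x \<otimes>\<^bsub>S\<^esub> inv\<^bsub>S\<^esub> g \<in> Q)}"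

definition fusion_iso :: "('a set \<Rightarrow> 'a set \<Rightarrow> ('a \<Rightarrow> 'a) set) \<Rightarrow> 'a set \<Rightarrow> 'a set \<Rightarrow> ('a \<Rightarrow> 'a) set" where
  "fusion_iso F P Q =
     {\<phi> \<in> F P Q. \<exists>\<psi> \<in> F Q P.
        compose P \<psi> \<phi> = (\<lambda>x \<in> P. x) \<and> compose Q \<phi> \<psi> = (\<lambda>x \<in> Q. x)}"

text \<open>Identities need no separate axiom: they are conjugations by the neutral element.\<close>

locale fusion_system = group S
  for p :: nat and S :: "('a, 'm) monoid_scheme" (structure)
    and F :: "'a set \<Rightarrow> 'a set \<Rightarrow> ('a \<Rightarrow> 'a) set" +
  assumes prime_p: "prime p"
    and finite_carrier: "finite (carrier S)"
    and p_group: "\<exists>n. order S = p ^ n"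
    and morphism_hom:
      "\<lbrakk>subgroup P S; subgroup Q S; \<phi> \<in> F P Q\<rbrakk>
        \<Longrightarrow> \<phi> \<in> extensional P \<and> \<phi> \<in> hom (S\<lparr>carrier := P\<rparr>) (S\<lparr>carrier := Q\<rparr>) \<and> inj_on \<phi> P"
    and morphism_compose:
      "\<lbrakk>subgroup P S; subgroup Q S; subgroup R S; \<phi> \<in> F P Q; \<psi> \<in> F Q R\<rbrakk>
        \<Longrightarrow> compose P \<psi> \<phi> \<in> F P R"
    and conj_hom_subset:
      "\<lbrakk>subgroup P S; subgroup Q S\<rbrakk> \<Longrightarrow> conj_hom S P Q \<subseteq> F P Q"
    and morphism_factor:
      "\<lbrakk>subgroup P S; subgroup Q S; \<phi> \<in> F P Q\<rbrakk>
        \<Longrightarrow> \<exists>R \<psi>. subgroup R S \<and> R \<subseteq> Q \<and> \<psi> \<in> fusion_iso F P R \<and> \<phi> = compose P (\<lambda>x \<in> R. x) \<psi>"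

definition fusion_conj :: "('a, 'm) monoid_scheme \<Rightarrow> ('a set \<Rightarrow> 'a set \<Rightarrow> ('a \<Rightarrow> 'a) set) \<Rightarrow> ('a set \<times> 'a set) set" where
  "fusion_conj S F = {(P, Q). subgroup P S \<and> subgroup Q S \<and> fusion_iso F P Q \<noteq> {}}"

definition sylow_subgroup :: "nat \<Rightarrow> ('a, 'm) monoid_scheme \<Rightarrow> 'a set \<Rightarrow> bool" where
  "sylow_subgroup p G H \<longleftrightarrow> subgroup H G \<and> card H = p ^ multiplicity p (order G)"

definition fully_automized ::
  "nat \<Rightarrow> ('a, 'm) monoid_scheme \<Rightarrow> ('a set \<Rightarrow> 'a set \<Rightarrow> ('a \<Rightarrow> 'a) set) \<Rightarrow> 'a set \<Rightarrow> bool" where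
  "fully_automized p S F P \<longleftrightarrow>
     sylow_subgroup p ((BijGroup P)\<lparr>carrier := F P P\<rparr>) (conj_hom S P P)"

definition extension_domain :: "('a, 'm) monoid_scheme \<Rightarrow> 'a set \<Rightarrow> 'a set \<Rightarrow> ('a \<Rightarrow> 'a) \<Rightarrow> 'a set" where
  "extension_domain S Q P \<phi> =
     {g \<in> normalizer S Q.
        (\<lambda>y \<in> P. \<phi> (g \<otimes>\<^bsub>S\<^esub> inv_into Q \<phi> y \<otimes>\<^bsub>S\<^esub> inv\<^bsub>S\<^esub> g)) \<in> conj_hom S P P}"

definition receptive ::
  "('a, 'm) monoid_scheme \<Rightarrow> ('a set \<Rightarrow> 'a set \<Rightarrow> ('a \<Rightarrow> 'a) set) \<Rightarrow> 'a set \<Rightarrow> bool" where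
  "receptive S F P \<longleftrightarrow>
     (\<forall>Q \<phi>. subgroup Q S \<and> \<phi> \<in> fusion_iso F Q P \<longrightarrow>
        (\<exists>R \<psi>. subgroup R S \<and> \<psi> \<in> F (extension_domain S Q P \<phi>) R \<and> (\<forall>x \<in> Q. \<psi> x = \<phi> x)))"

locale saturated_fusion_system = fusion_system +
  assumes saturated:
    "subgroup P S \<Longrightarrow> \<exists>Q. (P, Q) \<in> fusion_conj S F \<and> fully_automized p S F Q \<and> receptive S F Q"

definition maximal_subgroups :: "('a, 'm) monoid_scheme \<Rightarrow> 'a set set" where
  "maximal_subgroups S =
     {M. subgroup M S \<and> M \<noteq> carrier S \<and>
         (\<forall>K. subgroup K S \<and> M \<subseteq> K \<longrightarrow> K = M \<or> K = carrier S)}"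

section \<open>The Burnside ring of a fusion system and its unit group\<close>

definition fusion_burnside_ring ::
  "('a, 'm) monoid_scheme \<Rightarrow> ('a set \<Rightarrow> 'a set \<Rightarrow> ('a \<Rightarrow> 'a) set) \<Rightarrow> ('a gset \<times> 'a gset) set ring" where
  "fusion_burnside_ring S F = (burnside_ring S)\<lparr>carrier :=
     {a \<in> carrier (burnside_ring S).
        \<forall>(P, Q) \<in> fusion_conj S F. burnside_mark a P = burnside_mark a Q}\<rparr>"

text \<open>
  A multiplicatively written abelian group of exponent 2 as a vector space over \<open>residue_ring 2\<close>, whose
  carrier is \<open>{0, 1} :: int set\<close>: vector addition is the group operation, and \<open>k\<close> acts as the \<open>k\<close>-th
  power.  The ring multiplication and unit of the \<^typ>\<open>('a, 'b) module\<close> record are irrelevant for modules.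
\<close>

definition F2_space :: "('a, 'm) monoid_scheme \<Rightarrow> (int, 'a) module" where
  "F2_space U =
     \<lparr>carrier = carrier U, monoid.mult = undefined, one = undefined,
      zero = one U, add = monoid.mult U, smult = \<lambda>k x. x [^]\<^bsub>U\<^esub> k\<rparr>"

definition fusion_burnside_units ::
  "('a, 'm) monoid_scheme \<Rightarrow> ('a set \<Rightarrow> 'a set \<Rightarrow> ('a \<Rightarrow> 'a) set) \<Rightarrow> (int, ('a gset \<times> 'a gset) set) module" where
  "fusion_burnside_units S F = F2_space (units_of (fusion_burnside_ring S F))"

end

theory Submission
  imports Defs
begin

text \<open>
  Everything is read off from marks.  Two finite \<open>G\<close>-sets with equally many fixed points under every
  subgroup are isomorphic (remove orbits with maximal stabilizer one by one), so \<open>B(S)\<close> embeds into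
  the functions on subgroups, and units of \<open>B(\<F>)\<close> are the elements of \<open>B(\<F>)\<close> with all marks \<open>\<plusminus>1\<close>.

  Burnside's lemma on fixed points of \<open>K\<close> gives \<open>\<Sum>g\<in>S. |a\<^bsup>\<langle>K,g\<rangle>\<^esup>| \<equiv> 0\<close> modulo \<open>|S|\<close>.  For a unit \<open>a\<close> whose
  marks at all subgroups strictly above \<open>K\<close> are \<open>1\<close> this excludes \<open>|a\<^bsup>K\<^esup>| = -1\<close> as soon as \<open>[S:K] > 2\<close>.
  Hence a unit is determined by its marks at \<open>S\<close> and at the maximal subgroups, all of index 2.
  Conversely the signs there can be prescribed by products of \<open>-1\<close> and of \<open>1 - [S/M]\<close>.  As \<open>S\<close> is
  abelian, receptivity extends every isomorphism of \<open>\<F>\<close> to an automorphism of \<open>S\<close> in \<open>\<F>\<close>, which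
  permutes the maximal subgroups; so such a product lies in \<open>B(\<F>)\<close> when the set of \<open>M\<close> used is a
  union of \<open>\<F>\<close>-classes.  Thus there are \<open>2\<^bsup>s+1\<^esup>\<close> units.
\<close>

section \<open>Equivariant bijections\<close>

text \<open>Bijectivity is not among the assumptions: the map of \<open>inv g\<close> is a two-sided
  inverse of the map of \<open>g\<close>. Extensionality is what membership in
  \<open>BijGroup E\<close> demands in addition.\<close>

lemma group_actionI:
  fixes G (structure)
  assumes "group G"
    and ext: "\<And>g. g \<in> carrier G \<Longrightarrow> \<phi> g \<in> extensional E"
    and closed: "\<And>g x. g \<in> carrier G \<Longrightarrow> x \<in> E \<Longrightarrow> \<phi> g x \<in> E"
    and one: "\<And>x. x \<in> E \<Longrightarrow> \<phi> \<one> x = x"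
    and mult: "\<And>g h x. g \<in> carrier G \<Longrightarrow> h \<in> carrier G \<Longrightarrow> x \<in> E
                 \<Longrightarrow> \<phi> (g \<otimes> h) x = \<phi> g (\<phi> h x)"
  shows "group_action G E \<phi>"
proof -
  interpret group G by fact
  have Bij: "\<phi> g \<in> Bij E" if g: "g \<in> carrier G" for g
  proof -
    have "\<phi> g (\<phi> (inv g) x) = x" "\<phi> (inv g) (\<phi> g x) = x" if "x \<in> E" for x
      using mult[of g "inv g" x] mult[of "inv g" g x] one that g by simp_all
    then have "bij_betw (\<phi> g) E E"
      using closed g by (intro bij_betwI[where g = "\<phi> (inv g)"]) auto
    then show ?thesis
      using ext g by (simp add: Bij_def)
  qed
  have "\<phi> (g \<otimes> h) = compose E (\<phi> g) (\<phi> h)" if "g \<in> carrier G" "h \<in> carrier G" for g h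
    using that mult ext[of "g \<otimes> h"] by (intro extensionalityI[where A = E]) (auto simp: compose_eq)
  then have "\<phi> \<in> hom G (BijGroup E)"
    using Bij by (auto simp: hom_def BijGroup_def)
  then show ?thesis
    using \<open>group G\<close> group_BijGroup
    by (simp add: group_action_def group_hom_def group_hom_axioms_def)
qed

lemma (in group_action) group_G: "group G"
  using group_hom group_hom.axioms(1) by blast

lemma (in group_action) action_one: "x \<in> E \<Longrightarrow> \<phi> \<one> x = x"
  by (metis id_eq_one restrict_apply')

text \<open>Points of the orbit of \<open>x\<close> correspond to left cosets of its stabilizer;
  this lets two orbits be compared through stabilizers alone.\<close>

lemma (in group_action) action_eq_iff:
  assumes "x \<in> E" "g \<in> carrier G" "h \<in> carrier G"
  shows "\<phi> g x = \<phi> h x \<longleftrightarrow> inv h \<otimes> g \<in> stabilizer G \<phi> x"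
proof -
  interpret group G by (rule group_G)
  have "\<phi> (inv h \<otimes> g) x = \<phi> (inv h) (\<phi> g x)"
    using assms by (simp add: composition_rule)
  moreover have "\<phi> (inv h) (\<phi> h x) = x"
    using orbit_sym_aux assms by blast
  moreover have "inj_on (\<phi> (inv h)) E" "\<phi> g x \<in> E" "\<phi> h x \<in> E"
    using inj_prop element_image[OF assms(2,1) refl] element_image[OF assms(3,1) refl] assms(3)
    by simp_all
  ultimately have "\<phi> g x = \<phi> h x \<longleftrightarrow> \<phi> (inv h \<otimes> g) x = x"
    using inj_onD by metis
  then show ?thesis
    using assms by (simp add: stabilizer_def)
qed

text \<open>Both orbits are copies of the coset space of the common stabilizer, and the bijection
  sends the translate of \<open>x\<close> by \<open>g\<close> to the translate of \<open>y\<close>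
  by the same \<open>g\<close>.\<close>

lemma orbit_equivariant_bij:
  fixes G (structure)
  assumes "group_action G E \<phi>" "group_action G E' \<psi>"
    and x: "x \<in> E" and y: "y \<in> E'" and stab: "stabilizer G \<phi> x = stabilizer G \<psi> y"
  obtains f where "bij_betw f (orbit G \<phi> x) (orbit G \<psi> y)"
    "\<And>g z. g \<in> carrier G \<Longrightarrow> z \<in> orbit G \<phi> x \<Longrightarrow> f (\<phi> g z) = \<psi> g (f z)"
proof -
  interpret X: group_action G E \<phi> by fact
  interpret Y: group_action G E' \<psi> by fact
  interpret group G by (rule X.group_G)
  have eq: "\<phi> g x = \<phi> h x \<longleftrightarrow> \<psi> g y = \<psi> h y" if "g \<in> carrier G" "h \<in> carrier G" for g h
    using X.action_eq_iff Y.action_eq_iff that x y stab by auto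
  \<comment> \<open>The choice of \<open>g\<close> is harmless: by \<open>eq\<close>, two elements
    that agree on \<open>x\<close> agree on \<open>y\<close>. The converse direction of
    \<open>eq\<close> gives injectivity.\<close>
  define f where "f z = \<psi> (SOME g. g \<in> carrier G \<and> \<phi> g x = z) y" for z
  have f: "f (\<phi> g x) = \<psi> g y" if g: "g \<in> carrier G" for g
  proof -
    define h where "h = (SOME h. h \<in> carrier G \<and> \<phi> h x = \<phi> g x)"
    have "h \<in> carrier G \<and> \<phi> h x = \<phi> g x"
      unfolding h_def using someI[of "\<lambda>h. h \<in> carrier G \<and> \<phi> h x = \<phi> g x" g] g by simp
    then have "\<psi> h y = \<psi> g y"
      using eq g by blast
    then show ?thesis
      by (simp add: f_def h_def)
  qed
  have "f ` orbit G \<phi> x = orbit G \<psi> y"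
    using f by (force simp: orbit_def image_iff)
  moreover have "inj_on f (orbit G \<phi> x)"
    using f eq by (auto simp: orbit_def inj_on_def)
  ultimately have "bij_betw f (orbit G \<phi> x) (orbit G \<psi> y)"
    by (simp add: bij_betw_def)
  moreover have "f (\<phi> g z) = \<psi> g (f z)" if gz: "g \<in> carrier G" "z \<in> orbit G \<phi> x" for g z
  proof -
    obtain h where h: "h \<in> carrier G" "z = \<phi> h x"
      using gz(2) unfolding orbit_def by blast
    then show ?thesis
      using f[of "g \<otimes> h"] f[of h] gz(1) x y X.composition_rule Y.composition_rule by simp
  qed
  ultimately show ?thesis
    using that by blast
qed

text \<open>Induction on \<open>card A\<close>, splitting off one pair of isomorphic orbits at a
  time. \<open>A\<close> and \<open>B\<close> are invariant subsets of fixed ambient carriers, so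
  that the remainders need no new actions.\<close>

lemma equivariant_bij_of_card_fixed:
  fixes G (structure)
  assumes "group_action G E \<phi>" "group_action G E' \<psi>" and fin: "finite (carrier G)"
    and "finite A" "A \<subseteq> E" "\<And>g x. g \<in> carrier G \<Longrightarrow> x \<in> A \<Longrightarrow> \<phi> g x \<in> A"
    and "finite B" "B \<subseteq> E'" "\<And>g x. g \<in> carrier G \<Longrightarrow> x \<in> B \<Longrightarrow> \<psi> g x \<in> B"
    and "\<And>H. subgroup H G \<Longrightarrow>
           card {x \<in> A. \<forall>h\<in>H. \<phi> h x = x} = card {x \<in> B. \<forall>h\<in>H. \<psi> h x = x}"
  shows "\<exists>f. bij_betw f A B \<and> (\<forall>g\<in>carrier G. \<forall>x\<in>A. f (\<phi> g x) = \<psi> g (f x))"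
  using assms(4-)
proof (induction "card A" arbitrary: A B rule: less_induct)
  case less
  interpret X: group_action G E \<phi> by fact
  interpret Y: group_action G E' \<psi> by fact
  interpret group G by (rule X.group_G)
  note AE = less.prems(2) and Aclosed = less.prems(3) and BE = less.prems(5) and Bclosed = less.prems(6)
  let ?FA = "\<lambda>A H. {x \<in> A. \<forall>h\<in>H. \<phi> h x = x}" and ?FB = "\<lambda>B H. {x \<in> B. \<forall>h\<in>H. \<psi> h x = x}"
  have nonempty: "?FA A H \<noteq> {} \<longleftrightarrow> ?FB B H \<noteq> {}" if "subgroup H G" for H
  proof -
    have "finite (?FA A H)" "finite (?FB B H)"
      using less.prems(1,4) by auto
    then show ?thesis
      using less.prems(7)[OF that] card_eq_0_iff[of "?FA A H"] card_eq_0_iff[of "?FB B H"] by presburger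
  qed
  show ?case
  proof (cases "A = {}")
    case True
    \<comment> \<open>The trivial subgroup fixes every point, so its count detects
      emptiness.\<close>
    have "?FB B {\<one>} = {}"
      using nonempty[OF triv_subgroup] True by blast
    then have "B = {}"
      using BE Y.action_one by blast
    with True show ?thesis
      by (auto simp: bij_betw_def)
  next
    case False
    \<comment> \<open>Take \<open>x\<close> with stabilizer \<open>?H\<close> of maximal order.
      Since \<open>?H\<close> fixes a point of \<open>A\<close>, it fixes some \<open>y\<close> in
      \<open>B\<close>, so \<open>?H\<close> lies in \<open>?K\<close>. In turn \<open>?K\<close>
      fixes some \<open>z\<close> in \<open>A\<close>, and maximality bounds \<open>card ?K\<close>
      by \<open>card ?H\<close>. Hence \<open>?H = ?K\<close>.\<close>
    let ?stabs = "(\<lambda>x. card (stabilizer G \<phi> x)) ` A"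
    have "Max ?stabs \<in> ?stabs"
      using False less.prems(1) by (intro Max_in) auto
    then obtain x where x: "x \<in> A" and "card (stabilizer G \<phi> x) = Max ?stabs"
      by auto
    then have xmax: "card (stabilizer G \<phi> z) \<le> card (stabilizer G \<phi> x)" if "z \<in> A" for z
      using that less.prems(1) by simp
    have xE: "x \<in> E" using x AE by auto
    let ?H = "stabilizer G \<phi> x"
    have H: "subgroup ?H G" using X.stabilizer_subgroup xE .
    have "x \<in> ?FA A ?H" using x by (simp add: stabilizer_def)
    then obtain y where y: "y \<in> B" "\<forall>h\<in>?H. \<psi> h y = y"
      using nonempty[OF H] by blast
    have yE: "y \<in> E'" using y BE by auto
    let ?K = "stabilizer G \<psi> y"
    have K: "subgroup ?K G" using Y.stabilizer_subgroup yE .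
    have "y \<in> ?FB B ?K" using y by (simp add: stabilizer_def)
    then obtain z where z: "z \<in> A" "\<forall>h\<in>?K. \<phi> h z = z"
      using nonempty[OF K] by blast
    have finK: "finite ?K" and finz: "finite (stabilizer G \<phi> z)"
      using fin by (simp_all add: stabilizer_def)
    have "?H \<subseteq> ?K"
      using y by (auto simp: stabilizer_def)
    moreover have "?K \<subseteq> stabilizer G \<phi> z"
      using z by (auto simp: stabilizer_def)
    then have "card ?K \<le> card ?H"
      using card_mono[OF finz] xmax[OF z(1)] le_trans by blast
    ultimately have stab: "?H = ?K"
      using finK card_seteq by blast
    obtain f0 where f0: "bij_betw f0 (orbit G \<phi> x) (orbit G \<psi> y)"
      "\<And>g z. g \<in> carrier G \<Longrightarrow> z \<in> orbit G \<phi> x \<Longrightarrow> f0 (\<phi> g z) = \<psi> g (f0 z)"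
      using orbit_equivariant_bij[OF assms(1,2) xE yE stab] by blast
    let ?O = "orbit G \<phi> x" and ?P = "orbit G \<psi> y"
    have OA: "?O \<subseteq> A" and PB: "?P \<subseteq> B"
      using x y Aclosed Bclosed by (auto simp: orbit_def)
    have Oclosed: "\<phi> g z \<in> ?O \<longleftrightarrow> z \<in> ?O" if "g \<in> carrier G" "z \<in> E" for g z
    proof -
      have e: "\<phi> g z \<in> E" using X.element_image that by blast
      have "\<phi> g z \<in> orbit G \<phi> z" "z \<in> orbit G \<phi> (\<phi> g z)"
        using that X.orbit_sym[OF that(2) e] by (auto simp: orbit_def)
      then show ?thesis
        using X.orbit_trans[OF xE] that e by blast
    qed
    have Pclosed: "\<psi> g z \<in> ?P \<longleftrightarrow> z \<in> ?P" if "g \<in> carrier G" "z \<in> E'" for g z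
    proof -
      have e: "\<psi> g z \<in> E'" using Y.element_image that by blast
      have "\<psi> g z \<in> orbit G \<psi> z" "z \<in> orbit G \<psi> (\<psi> g z)"
        using that Y.orbit_sym[OF that(2) e] by (auto simp: orbit_def)
      then show ?thesis
        using Y.orbit_trans[OF yE] that e by blast
    qed
    \<comment> \<open>The removed orbits have equal fixed-point counts, so subtracting them
      preserves the counting hypothesis.\<close>
    have cardOP: "card (?FA ?O H) = card (?FB ?P H)" if "subgroup H G" for H
    proof -
      have HG: "H \<subseteq> carrier G" using that subgroup.subset by blast
      have "f0 ` ?FA ?O H = ?FB ?P H"
      proof (intro equalityI subsetI)
        fix w assume "w \<in> f0 ` ?FA ?O H"
        then obtain v where v: "v \<in> ?O" "\<forall>h\<in>H. \<phi> h v = v" "w = f0 v" by auto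
        then have "\<psi> h w = w" if "h \<in> H" for h
          using f0(2)[of h v] that HG by auto
        then show "w \<in> ?FB ?P H"
          using v f0(1) by (auto simp: bij_betw_def)
      next
        fix w assume w: "w \<in> ?FB ?P H"
        then obtain v where v: "v \<in> ?O" "w = f0 v"
          using f0(1) by (auto simp: bij_betw_def)
        have "\<phi> h v = v" if "h \<in> H" for h
        proof -
          have "f0 (\<phi> h v) = f0 v" using f0(2)[of h v] that HG v w by auto
          moreover have "\<phi> h v \<in> ?O"
            using Oclosed that HG v OA AE by blast
          ultimately show ?thesis
            using f0(1) v by (auto simp: bij_betw_def inj_on_def)
        qed
        then show "w \<in> f0 ` ?FA ?O H" using v by auto
      qed
      moreover have "inj_on f0 (?FA ?O H)"
        using f0(1) by (auto simp: bij_betw_def inj_on_def)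
      ultimately show ?thesis
        using card_image by fastforce
    qed
    have "\<exists>f. bij_betw f (A - ?O) (B - ?P) \<and> (\<forall>g\<in>carrier G. \<forall>x\<in>A - ?O. f (\<phi> g x) = \<psi> g (f x))"
    proof (rule less.hyps)
      have "x \<in> ?O" using X.orbit_refl xE .
      then show "card (A - ?O) < card A"
        using x less.prems(1) by (intro psubset_card_mono) auto
      show "finite (A - ?O)" "A - ?O \<subseteq> E" "finite (B - ?P)" "B - ?P \<subseteq> E'"
        using less.prems by auto
      show "\<phi> g z \<in> A - ?O" if "g \<in> carrier G" "z \<in> A - ?O" for g z
        using Oclosed that AE Aclosed by blast
      show "\<psi> g z \<in> B - ?P" if "g \<in> carrier G" "z \<in> B - ?P" for g z
        using Pclosed that BE Bclosed by blast
      fix H assume H: "subgroup H G"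
      have "?FA (A - ?O) H = ?FA A H - ?FA ?O H" "?FB (B - ?P) H = ?FB B H - ?FB ?P H"
        by auto
      moreover have "card (?FA A H - ?FA ?O H) = card (?FA A H) - card (?FA ?O H)"
        using OA less.prems(1) by (intro card_Diff_subset) (auto intro: finite_subset)
      moreover have "card (?FB B H - ?FB ?P H) = card (?FB B H) - card (?FB ?P H)"
        using PB less.prems(4) by (intro card_Diff_subset) (auto intro: finite_subset)
      ultimately show "card (?FA (A - ?O) H) = card (?FB (B - ?P) H)"
        using cardOP[OF H] less.prems(7)[OF H] by simp
    qed
    then obtain f1 where f1: "bij_betw f1 (A - ?O) (B - ?P)"
      "\<And>g x. g \<in> carrier G \<Longrightarrow> x \<in> A - ?O \<Longrightarrow> f1 (\<phi> g x) = \<psi> g (f1 x)"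
      by blast
    define f where "f z = (if z \<in> ?O then f0 z else f1 z)" for z
    have "bij_betw f (?O \<union> (A - ?O)) (?P \<union> (B - ?P))"
    proof (rule bij_betw_combine)
      show "bij_betw f ?O ?P"
        using f0(1) bij_betw_cong[of ?O f f0] by (simp add: f_def)
      show "bij_betw f (A - ?O) (B - ?P)"
        using f1(1) bij_betw_cong[of "A - ?O" f f1] by (simp add: f_def)
    qed auto
    moreover have "?O \<union> (A - ?O) = A" "?P \<union> (B - ?P) = B"
      using OA PB by auto
    moreover have "f (\<phi> g z) = \<psi> g (f z)" if "g \<in> carrier G" "z \<in> A" for g z
      using that f0(2) f1(2) Oclosed AE by (auto simp: f_def)
    ultimately show ?thesis by metis
  qed
qed

section \<open>Marks on the Burnside ring\<close>

lemma gset_fixed_sum: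
  "gset_fixed (gset_sum X Y) H = sum_encode ` (gset_fixed X H <+> gset_fixed Y H)"
  by (auto simp: gset_fixed_def gset_sum_def Let_def sum_encode_eq
      inj_image_mem_iff[OF inj_sum_encode])

lemma gset_fixed_prod:
  "gset_fixed (gset_prod X Y) H = prod_encode ` (gset_fixed X H \<times> gset_fixed Y H)"
  by (auto simp: gset_fixed_def gset_prod_def Let_def)

lemma finite_gset_fixed: "finite (fst X) \<Longrightarrow> finite (gset_fixed X H)"
  by (simp add: gset_fixed_def)

lemma card_gset_fixed_sum:
  assumes "finite (fst X)" "finite (fst Y)"
  shows "card (gset_fixed (gset_sum X Y) H) = card (gset_fixed X H) + card (gset_fixed Y H)"
  using assms
  by (simp add: gset_fixed_sum card_image inj_sum_encode card_Plus finite_gset_fixed)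

lemma card_gset_fixed_prod:
  "card (gset_fixed (gset_prod X Y) H) = card (gset_fixed X H) * card (gset_fixed Y H)"
  by (simp add: gset_fixed_prod card_image inj_prod_encode card_cartesian_product)

text \<open>The mark on a representative; \<open>burnside_mark_class\<close> transfers it to
  classes, so that ring identities become integer arithmetic.\<close>

definition virtual_mark :: "'g gset \<times> 'g gset \<Rightarrow> 'g set \<Rightarrow> int" where
  "virtual_mark u H = int (card (gset_fixed (fst u) H)) - int (card (gset_fixed (snd u) H))"

locale finite_group = group +
  assumes finite_carrier: "finite (carrier G)"
begin

lemma fin_gsetsI:
  assumes "finite E"
    and "\<And>g. g \<in> carrier G \<Longrightarrow> \<phi> g \<in> extensional E"
    and "\<And>g x. g \<in> carrier G \<Longrightarrow> x \<in> E \<Longrightarrow> \<phi> g x \<in> E"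
    and "\<And>x. x \<in> E \<Longrightarrow> \<phi> \<one> x = x"
    and "\<And>g h x. g \<in> carrier G \<Longrightarrow> h \<in> carrier G \<Longrightarrow> x \<in> E \<Longrightarrow> \<phi> (g \<otimes> h) x = \<phi> g (\<phi> h x)"
  shows "(E, \<phi>) \<in> fin_gsets G"
  using assms group_actionI[OF is_group, of \<phi> E] by (simp add: fin_gsets_def)

lemma fin_gsets_action: "X \<in> fin_gsets G \<Longrightarrow> group_action G (fst X) (snd X)"
  and fin_gsets_finite: "X \<in> fin_gsets G \<Longrightarrow> finite (fst X)"
  by (auto simp: fin_gsets_def)

lemma gset_empty_closed: "gset_empty \<in> fin_gsets G"
  unfolding gset_empty_def by (rule fin_gsetsI) auto

lemma gset_point_closed: "gset_point \<in> fin_gsets G"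
  unfolding gset_point_def by (rule fin_gsetsI) auto

lemma gset_sum_closed:
  assumes X: "X \<in> fin_gsets G" and Y: "Y \<in> fin_gsets G"
  shows "gset_sum X Y \<in> fin_gsets G"
proof -
  interpret X: group_action G "fst X" "snd X" using X by (rule fin_gsets_action)
  interpret Y: group_action G "fst Y" "snd Y" using Y by (rule fin_gsets_action)
  note X.element_image[OF _ _ refl, simp] Y.element_image[OF _ _ refl, simp]
  show ?thesis
    unfolding gset_sum_def Let_def
    by (rule fin_gsetsI)
      (auto simp: fin_gsets_finite[OF X] fin_gsets_finite[OF Y] inj_image_mem_iff[OF inj_sum_encode]
        X.action_one Y.action_one X.composition_rule Y.composition_rule)
qed

lemma gset_prod_closed:
  assumes X: "X \<in> fin_gsets G" and Y: "Y \<in> fin_gsets G"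
  shows "gset_prod X Y \<in> fin_gsets G"
proof -
  interpret X: group_action G "fst X" "snd X" using X by (rule fin_gsets_action)
  interpret Y: group_action G "fst Y" "snd Y" using Y by (rule fin_gsets_action)
  note X.element_image[OF _ _ refl, simp] Y.element_image[OF _ _ refl, simp]
  show ?thesis
    unfolding gset_prod_def Let_def
    by (rule fin_gsetsI)
      (auto simp: fin_gsets_finite[OF X] fin_gsets_finite[OF Y] image_iff X.action_one Y.action_one
        X.composition_rule Y.composition_rule)
qed

text \<open>An isomorphism restricts to bijections between fixed-point sets; the converse is the
  orbit-removal argument above.\<close>

lemma gset_iso_iff_card_fixed:
  assumes X: "X \<in> fin_gsets G" and Y: "Y \<in> fin_gsets G"
  shows "gset_iso G X Y \<longleftrightarrow>
    (\<forall>H. subgroup H G \<longrightarrow> card (gset_fixed X H) = card (gset_fixed Y H))"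
proof
  assume "gset_iso G X Y"
  then obtain f where bij: "bij_betw f (fst X) (fst Y)"
    and eqv: "\<And>g x. g \<in> carrier G \<Longrightarrow> x \<in> fst X \<Longrightarrow> f (snd X g x) = snd Y g (f x)"
    unfolding gset_iso_def by blast
  interpret X: group_action G "fst X" "snd X" using X by (rule fin_gsets_action)
  show "\<forall>H. subgroup H G \<longrightarrow> card (gset_fixed X H) = card (gset_fixed Y H)"
  proof (intro allI impI)
    fix H assume "subgroup H G"
    then have H: "h \<in> carrier G" if "h \<in> H" for h
      using that subgroup.mem_carrier by metis
    have fixed: "snd X h x = x \<longleftrightarrow> snd Y h (f x) = f x" if "h \<in> H" "x \<in> fst X" for h x
      using eqv[OF H[OF that(1)] that(2)] bij X.element_image[OF H[OF that(1)] that(2) refl] that(2)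
      by (metis bij_betw_imp_inj_on inj_onD)
    have "f ` gset_fixed X H = gset_fixed Y H"
    proof (intro equalityI subsetI)
      fix y assume y: "y \<in> gset_fixed Y H"
      then obtain x where "x \<in> fst X" "y = f x"
        using bij by (auto simp: gset_fixed_def bij_betw_def)
      then show "y \<in> f ` gset_fixed X H"
        using y fixed by (auto simp: gset_fixed_def)
    qed (use bij fixed in \<open>auto simp: gset_fixed_def bij_betw_def\<close>)
    moreover have "inj_on f (gset_fixed X H)"
      using bij by (auto simp: bij_betw_def gset_fixed_def inj_on_def)
    ultimately show "card (gset_fixed X H) = card (gset_fixed Y H)"
      using card_image by fastforce
  qed
next
  assume "\<forall>H. subgroup H G \<longrightarrow> card (gset_fixed X H) = card (gset_fixed Y H)"
  then show "gset_iso G X Y"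
    unfolding gset_iso_def gset_fixed_def
    using finite_carrier fin_gsets_finite[OF X] fin_gsets_finite[OF Y]
      fin_gsets_action[OF X] fin_gsets_action[OF Y]
      group_action.element_image[OF fin_gsets_action[OF X] _ _ refl]
      group_action.element_image[OF fin_gsets_action[OF Y] _ _ refl]
    by (intro equivariant_bij_of_card_fixed) auto
qed

text \<open>Fixed-point counts are additive, so the stabilizing summand \<open>Z\<close> cancels;
  conversely the empty set serves as \<open>Z\<close>. From here on the Grothendieck relation is
  mere equality of marks.\<close>

lemma burnside_rel_iff:
  "(u, v) \<in> burnside_rel G \<longleftrightarrow>
     u \<in> fin_gsets G \<times> fin_gsets G \<and> v \<in> fin_gsets G \<times> fin_gsets G \<and>
     (\<forall>H. subgroup H G \<longrightarrow> virtual_mark u H = virtual_mark v H)"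
proof (cases "u \<in> fin_gsets G \<times> fin_gsets G \<and> v \<in> fin_gsets G \<times> fin_gsets G")
  case True
  then obtain X Y X' Y' where uv: "u = (X, Y)" "v = (X', Y')"
    and fin: "X \<in> fin_gsets G" "Y \<in> fin_gsets G" "X' \<in> fin_gsets G" "Y' \<in> fin_gsets G"
    by auto
  have "gset_iso G (gset_sum (gset_sum X Y') Z) (gset_sum (gset_sum X' Y) Z) \<longleftrightarrow>
      (\<forall>H. subgroup H G \<longrightarrow> virtual_mark u H = virtual_mark v H)" if "Z \<in> fin_gsets G" for Z
    using fin that
    by (auto simp: gset_iso_iff_card_fixed gset_sum_closed card_gset_fixed_sum fin_gsets_finite
        virtual_mark_def uv)
  then show ?thesis
    using fin gset_empty_closed unfolding burnside_rel_def uv by blast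
next
  case False
  then show ?thesis
    by (auto simp: burnside_rel_def)
qed

lemma equiv_burnside_rel: "equiv (fin_gsets G \<times> fin_gsets G) (burnside_rel G)"
  by (rule equivI) (auto simp: refl_on_def sym_def trans_def burnside_rel_iff simp del: mem_Sigma_iff)

lemma virtual_mark_mult:
  assumes "u \<in> fin_gsets G \<times> fin_gsets G" "v \<in> fin_gsets G \<times> fin_gsets G"
  shows "virtual_mark (virtual_mult u v) H = virtual_mark u H * virtual_mark v H"
  using assms
  by (auto simp: virtual_mark_def virtual_mult_def card_gset_fixed_sum card_gset_fixed_prod
      gset_prod_closed fin_gsets_finite algebra_simps)

lemma virtual_mult_closed:
  assumes "u \<in> fin_gsets G \<times> fin_gsets G" "v \<in> fin_gsets G \<times> fin_gsets G"
  shows "virtual_mult u v \<in> fin_gsets G \<times> fin_gsets G"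
  using assms by (auto simp: virtual_mult_def gset_sum_closed gset_prod_closed)

abbreviation burnside_class :: "'a gset \<times> 'a gset \<Rightarrow> ('a gset \<times> 'a gset) set" where
  "burnside_class u \<equiv> burnside_rel G `` {u}"

lemma burnside_class_closed:
  "u \<in> fin_gsets G \<times> fin_gsets G \<Longrightarrow> burnside_class u \<in> carrier (burnside_ring G)"
  unfolding burnside_ring_def by (simp add: quotientI)

lemma burnside_carrierE:
  assumes "a \<in> carrier (burnside_ring G)"
  obtains u where "u \<in> fin_gsets G \<times> fin_gsets G" "a = burnside_class u"
  using assms unfolding burnside_ring_def by (auto elim: quotientE)

lemma burnside_mark_class:
  assumes "u \<in> fin_gsets G \<times> fin_gsets G" "subgroup H G"
  shows "burnside_mark (burnside_class u) H = virtual_mark u H"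
proof -
  have "(\<lambda>(X, Y). int (card (gset_fixed X H)) - int (card (gset_fixed Y H))) =
      (\<lambda>u. virtual_mark u H)"
    by (auto simp: virtual_mark_def)
  moreover have "(\<lambda>u. virtual_mark u H) ` burnside_class u = {virtual_mark u H}"
    using assms by (auto simp: burnside_rel_iff image_iff simp del: mem_Sigma_iff)
  ultimately show ?thesis
    by (simp add: burnside_mark_def)
qed

text \<open>Injectivity of the mark map. Equalities between elements of the Burnside ring are
  checked below through it.\<close>

lemma burnside_eqI:
  assumes "a \<in> carrier (burnside_ring G)" "b \<in> carrier (burnside_ring G)"
    and "\<And>H. subgroup H G \<Longrightarrow> burnside_mark a H = burnside_mark b H"
  shows "a = b"
proof -
  obtain u v where u: "u \<in> fin_gsets G \<times> fin_gsets G" "a = burnside_class u"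
    and v: "v \<in> fin_gsets G \<times> fin_gsets G" "b = burnside_class v"
    using burnside_carrierE assms(1,2) by metis
  then have "(u, v) \<in> burnside_rel G"
    using assms(3) by (simp add: burnside_rel_iff burnside_mark_class del: mem_Sigma_iff)
  then show ?thesis
    using u v equiv_class_eq[OF equiv_burnside_rel] by simp
qed

text \<open>The product does not depend on representatives because marks are multiplicative and
  determine the class.\<close>

lemma burnside_mult_class:
  assumes "u \<in> fin_gsets G \<times> fin_gsets G" "v \<in> fin_gsets G \<times> fin_gsets G"
  shows "burnside_class u \<otimes>\<^bsub>burnside_ring G\<^esub> burnside_class v = burnside_class (virtual_mult u v)"
proof -
  have "congruent2 (burnside_rel G) (burnside_rel G) (\<lambda>u v. burnside_class (virtual_mult u v))"
    by (intro congruent2I' equiv_class_eq[OF equiv_burnside_rel])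
      (simp add: burnside_rel_iff virtual_mult_closed virtual_mark_mult del: mem_Sigma_iff)
  from UN_equiv_class2[OF equiv_burnside_rel equiv_burnside_rel this assms]
  show ?thesis
    by (simp add: burnside_ring_def)
qed

lemma burnside_mult_closed:
  assumes "a \<in> carrier (burnside_ring G)" "b \<in> carrier (burnside_ring G)"
  shows "a \<otimes>\<^bsub>burnside_ring G\<^esub> b \<in> carrier (burnside_ring G)"
  using assms
  by (elim burnside_carrierE) (simp add: burnside_mult_class burnside_class_closed virtual_mult_closed)

lemma burnside_mark_mult:
  assumes "a \<in> carrier (burnside_ring G)" "b \<in> carrier (burnside_ring G)" "subgroup H G"
  shows "burnside_mark (a \<otimes>\<^bsub>burnside_ring G\<^esub> b) H = burnside_mark a H * burnside_mark b H"
  using assms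
  by (elim burnside_carrierE)
    (simp add: burnside_mult_class burnside_mark_class virtual_mult_closed virtual_mark_mult)

lemma burnside_one_closed: "\<one>\<^bsub>burnside_ring G\<^esub> \<in> carrier (burnside_ring G)"
  using burnside_class_closed[of "(gset_point, gset_empty)"] gset_point_closed gset_empty_closed
  by (simp add: burnside_ring_def)

lemma gset_fixed_point: "gset_fixed gset_point H = {0}"
  and gset_fixed_empty: "gset_fixed gset_empty H = {}"
  by (auto simp: gset_fixed_def gset_point_def gset_empty_def)

lemma burnside_mark_one: "subgroup H G \<Longrightarrow> burnside_mark \<one>\<^bsub>burnside_ring G\<^esub> H = 1"
  using burnside_mark_class[of "(gset_point, gset_empty)" H] gset_point_closed gset_empty_closed
  by (simp add: burnside_ring_def virtual_mark_def gset_fixed_point gset_fixed_empty)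

lemma burnside_minus_one:
  obtains a where "a \<in> carrier (burnside_ring G)" "\<And>H. subgroup H G \<Longrightarrow> burnside_mark a H = -1"
proof
  \<comment> \<open>The additive inverse of the class of a point.\<close>
  have u: "(gset_empty, gset_point) \<in> fin_gsets G \<times> fin_gsets G"
    using gset_point_closed gset_empty_closed by simp
  show "burnside_class (gset_empty, gset_point) \<in> carrier (burnside_ring G)"
    using u by (rule burnside_class_closed)
  show "burnside_mark (burnside_class (gset_empty, gset_point)) H = -1" if "subgroup H G" for H
    using burnside_mark_class[OF u that]
    by (simp add: virtual_mark_def gset_fixed_point gset_fixed_empty)
qed

end

section \<open>Congruences between marks\<close>

context finite_group
begin

text \<open>A stabilizer is a subgroup, so it contains \<open>A\<close> exactly when it contains the
  subgroup generated by \<open>A\<close>.\<close>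

lemma gset_fixed_generate:
  assumes X: "X \<in> fin_gsets G" and A: "A \<subseteq> carrier G"
  shows "gset_fixed X (generate G A) = gset_fixed X A"
proof (intro equalityI subsetI)
  interpret X: group_action G "fst X" "snd X" using X by (rule fin_gsets_action)
  fix x assume x: "x \<in> gset_fixed X A"
  then have xE: "x \<in> fst X" and "A \<subseteq> stabilizer G (snd X) x"
    using A by (auto simp: gset_fixed_def stabilizer_def)
  then have "generate G A \<subseteq> stabilizer G (snd X) x"
    using generate_subgroup_incl X.stabilizer_subgroup by blast
  then show "x \<in> gset_fixed X (generate G A)"
    using xE by (auto simp: gset_fixed_def stabilizer_def)
qed (auto simp: gset_fixed_def generate.incl)

text \<open>Burnside's lemma for the action of \<open>G\<close> on the fixed points of a normal subgroup \<open>K\<close>.\<close>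

lemma order_dvd_sum_card_fixed:
  assumes X: "X \<in> fin_gsets G" and K: "K \<lhd> G"
  shows "order G dvd (\<Sum>g\<in>carrier G. card (gset_fixed X (generate G (insert g K))))"
proof -
  interpret X: group_action G "fst X" "snd X" using X by (rule fin_gsets_action)
  interpret K: normal K G by fact
  let ?E = "gset_fixed X K" and ?\<phi> = "\<lambda>g. restrict (snd X g) (gset_fixed X K)"
  have closed: "snd X g x \<in> ?E" if "g \<in> carrier G" "x \<in> ?E" for g x
  proof -
    have x: "x \<in> fst X" "\<And>k. k \<in> K \<Longrightarrow> snd X k x = x"
      using that by (auto simp: gset_fixed_def)
    have "snd X k (snd X g x) = snd X g x" if k: "k \<in> K" for k
    proof -
      have kG: "k \<in> carrier G" using k by auto
      have conj: "inv g \<otimes> k \<otimes> g \<in> K"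
        using K.inv_op_closed1 \<open>g \<in> carrier G\<close> k by blast
      have "snd X k (snd X g x) = snd X (k \<otimes> g) x"
        using X.composition_rule x kG \<open>g \<in> carrier G\<close> by simp
      \<comment> \<open>Normality puts the conjugate \<open>inv g \<otimes> k \<otimes> g\<close>
        into \<open>K\<close>, where it fixes \<open>x\<close>.\<close>
      also have "k \<otimes> g = g \<otimes> (inv g \<otimes> k \<otimes> g)"
        using kG \<open>g \<in> carrier G\<close> by (simp add: m_assoc[symmetric])
      also have "snd X \<dots> x = snd X g (snd X (inv g \<otimes> k \<otimes> g) x)"
        using x(1) \<open>g \<in> carrier G\<close> conj by (intro X.composition_rule) auto
      finally show ?thesis
        using x(2)[OF conj] by simp
    qed
    then show ?thesis
      using X.element_image[OF that(1) x(1) refl] by (simp add: gset_fixed_def)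
  qed
  have E: "?E \<subseteq> fst X" by (auto simp: gset_fixed_def)
  have act: "group_action G ?E ?\<phi>"
  proof (rule group_actionI[OF is_group])
    show "?\<phi> \<one> x = x" if "x \<in> ?E" for x
      using that E X.action_one by auto
    show "?\<phi> (g \<otimes> h) x = ?\<phi> g (?\<phi> h x)" if "g \<in> carrier G" "h \<in> carrier G" "x \<in> ?E" for g h x
      using that E closed X.composition_rule by auto
  qed (use closed in auto)
  have "finite ?E"
    using fin_gsets_finite[OF X] by (rule finite_gset_fixed)
  \<comment> \<open>A point fixed by \<open>K\<close> and by \<open>g\<close> is fixed by the
    subgroup they generate; this turns the orbit count into a sum of marks.\<close>
  have "card (invariants ?E ?\<phi> g) = card (gset_fixed X (generate G (insert g K)))"
    if "g \<in> carrier G" for g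
  proof -
    have "gset_fixed X (generate G (insert g K)) = gset_fixed X (insert g K)"
      using X that K.subset by (intro gset_fixed_generate) auto
    also have "\<dots> = invariants ?E ?\<phi> g"
      by (auto simp: invariants_def gset_fixed_def)
    finally show ?thesis by simp
  qed
  then have "(\<Sum>g\<in>carrier G. card (gset_fixed X (generate G (insert g K)))) =
      card (orbits G ?E ?\<phi>) * order G"
    using group_action.burnside[OF act finite_carrier \<open>finite ?E\<close>] by simp
  then show ?thesis by simp
qed

text \<open>The congruence for actual sets passes to virtual ones because the sum is additive in the
  element.\<close>

lemma order_dvd_sum_marks:
  assumes a: "a \<in> carrier (burnside_ring G)" and K: "K \<lhd> G"
  shows "int (order G) dvd (\<Sum>g\<in>carrier G. burnside_mark a (generate G (insert g K)))"
proof -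
  obtain u where u: "u \<in> fin_gsets G \<times> fin_gsets G" "a = burnside_class u"
    using a by (rule burnside_carrierE)
  have "K \<subseteq> carrier G"
    using K normal_imp_subgroup subgroup.subset by blast
  then have "subgroup (generate G (insert g K)) G" if "g \<in> carrier G" for g
    using that generate_is_subgroup by simp
  then have "(\<Sum>g\<in>carrier G. burnside_mark a (generate G (insert g K))) =
      int (\<Sum>g\<in>carrier G. card (gset_fixed (fst u) (generate G (insert g K)))) -
      int (\<Sum>g\<in>carrier G. card (gset_fixed (snd u) (generate G (insert g K))))"
    using u by (simp add: burnside_mark_class virtual_mark_def sum_subtractf)
  moreover have "int (order G) dvd \<dots>"
    using u K by (intro dvd_diff) (simp_all only: int_dvd_int_iff order_dvd_sum_card_fixed mem_Times_iff)
  ultimately show ?thesis by simp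
qed

text \<open>Suppose the mark at \<open>K\<close> is -1. In the sum of marks over \<open>g\<close>,
  elements of \<open>K\<close> contribute -1 and all others 1, since they generate something
  strictly larger with \<open>K\<close>. So the order of the group divides itself minus
  \<open>2 * card K\<close>, hence divides \<open>2 * card K\<close>, which is positive and too
  small.\<close>

lemma burnside_mark_eq_1I:
  assumes a: "a \<in> carrier (burnside_ring G)" and K: "K \<lhd> G" and index: "2 * card K < order G"
    and above: "\<And>L. subgroup L G \<Longrightarrow> K \<subset> L \<Longrightarrow> burnside_mark a L = 1"
    and sign: "burnside_mark a K \<in> {1, -1}"
  shows "burnside_mark a K = 1"
proof (rule ccontr)
  assume "burnside_mark a K \<noteq> 1"
  then have minus: "burnside_mark a K = -1" using sign by blast
  have sub: "subgroup K G" using K normal_imp_subgroup by blast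
  then have KG: "K \<subseteq> carrier G" using subgroup.subset by blast
  have finK: "finite K" using KG finite_carrier finite_subset by blast
  have "0 < card K"
    using finK subgroup.one_closed[OF sub] card_gt_0_iff by blast
  have "generate G (insert g K) = K" if "g \<in> K" for g
    using that generateI[OF sub, of K] sub by (simp add: insert_absorb)
  then have in_K: "burnside_mark a (generate G (insert g K)) = -1" if "g \<in> K" for g
    using minus that by simp
  have out_K: "burnside_mark a (generate G (insert g K)) = 1" if "g \<in> carrier G - K" for g
  proof (rule above)
    show "subgroup (generate G (insert g K)) G"
      using that KG generate_is_subgroup by simp
    have "insert g K \<subseteq> generate G (insert g K)"
      by (auto intro: generate.incl)
    then show "K \<subset> generate G (insert g K)"
      using that by auto
  qed
  have "(\<Sum>g\<in>carrier G. burnside_mark a (generate G (insert g K))) =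
      (\<Sum>g\<in>carrier G - K. burnside_mark a (generate G (insert g K))) +
      (\<Sum>g\<in>K. burnside_mark a (generate G (insert g K)))"
    using KG finite_carrier by (rule sum.subset_diff)
  also have "\<dots> = int (card (carrier G - K)) - int (card K)"
    using in_K out_K by simp
  also have "\<dots> = int (order G) - int (2 * card K)"
    using KG finK card_mono[OF finite_carrier KG] by (simp add: card_Diff_subset order_def)
  finally have "int (order G) dvd int (order G) - int (2 * card K)"
    using order_dvd_sum_marks[OF a K] by simp
  then have "order G dvd 2 * card K"
    using dvd_diff_right_iff[of "int (order G)" "int (order G)" "int (2 * card K)"]
    by (simp only: int_dvd_int_iff dvd_refl dvd_diff_commute)
  then show False
    using index \<open>0 < card K\<close> dvd_imp_le by fastforce
qed

lemma card_subgroup_cases: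
  assumes K: "subgroup K G"
  obtains "K = carrier G" | "2 * card K = order G" | "2 * card K < order G"
proof -
  have KG: "K \<subseteq> carrier G" using K subgroup.subset by blast
  have ord: "card (rcosets K) * card K = order G"
    using lagrange[OF K] .
  consider "card (rcosets K) = 0" | "card (rcosets K) = 1" | "card (rcosets K) = 2"
    | "card (rcosets K) > 2" by linarith
  then show ?thesis
  proof cases
    case 1
    then show ?thesis
      using ord order_gt_0_iff_finite finite_carrier by simp
  next
    case 2
    then have "K = carrier G"
      using ord KG finite_carrier by (intro card_subset_eq) (auto simp: order_def)
    then show ?thesis by (rule that(1))
  next
    case 3
    then show ?thesis using ord that(2) by simp
  next
    case 4
    have "card K > 0"
      using ord order_gt_0_iff_finite finite_carrier by (metis mult_is_0 not_gr0)
    then show ?thesis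
      using ord 4 that(3) by (metis mult_less_mono1)
  qed
qed

text \<open>Descending induction from the whole group: the measure \<open>order G - card K\<close>
  drops as \<open>K\<close> grows. Index 1 and 2 are given, and at larger index
  \<open>burnside_mark_eq_1I\<close> applies since every subgroup of an abelian group is
  normal.\<close>

lemma burnside_mark_determined:
  assumes "comm_group G" and a: "a \<in> carrier (burnside_ring G)"
    and sign: "\<And>H. subgroup H G \<Longrightarrow> burnside_mark a H \<in> {1, -1}"
    and top: "burnside_mark a (carrier G) = 1"
    and index2: "\<And>M. subgroup M G \<Longrightarrow> 2 * card M = order G \<Longrightarrow> burnside_mark a M = 1"
    and K: "subgroup K G"
  shows "burnside_mark a K = 1"
  using K
proof (induction "order G - card K" arbitrary: K rule: less_induct)
  case less
  interpret comm_group G by fact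
  show ?case
    using less.prems
  proof (cases rule: card_subgroup_cases)
    case 1
    then show ?thesis using top by simp
  next
    case 2
    then show ?thesis using index2 less.prems by simp
  next
    case 3
    show ?thesis
    proof (rule burnside_mark_eq_1I[OF a _ 3 _ sign[OF less.prems]])
      show "K \<lhd> G"
        using less.prems by (rule subgroup_imp_normal)
      fix L assume L: "subgroup L G" "K \<subset> L"
      then have "L \<subseteq> carrier G" using subgroup.subset by blast
      then have "card K < card L" "card L \<le> order G"
        using L finite_carrier by (auto simp: order_def intro: psubset_card_mono card_mono finite_subset)
      then show "burnside_mark a L = 1"
        using L(1) by (intro less.hyps) auto
    qed
  qed
qed

text \<open>\<open>M\<close> and its translate by \<open>inv g\<close> are disjoint halves of the
  group, so \<open>h\<close>, lying outside \<open>M\<close>, lies in the translate.\<close>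

lemma index_two_mult_mem:
  assumes M: "subgroup M G" and index: "2 * card M = order G"
    and g: "g \<in> carrier G" "g \<notin> M" and h: "h \<in> carrier G" "h \<notin> M"
  shows "g \<otimes> h \<in> M"
proof -
  have MG: "M \<subseteq> carrier G" using M subgroup.subset by blast
  have finM: "finite M" using MG finite_carrier finite_subset by blast
  let ?N = "(\<lambda>m. inv g \<otimes> m) ` M"
  have "card ?N = card M"
    using MG g by (intro card_image inj_on_subset[OF inj_on_cmult]) auto
  moreover have "M \<inter> ?N = {}"
  proof -
    have False if m: "m \<in> M" "inv g \<otimes> m \<in> M" for m
    proof -
      have mG: "m \<in> carrier G" using m(1) MG by auto
      have "m \<otimes> inv (inv g \<otimes> m) \<in> M"
        using m M by (simp add: subgroup.m_closed subgroup.m_inv_closed)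
      moreover have "m \<otimes> inv (inv g \<otimes> m) = g"
        using mG g by (simp add: inv_mult_group m_assoc[symmetric])
      ultimately show False using g by simp
    qed
    then show ?thesis by auto
  qed
  ultimately have "card (M \<union> ?N) = card (carrier G)"
    using index finM by (simp add: card_Un_disjoint order_def)
  then have "M \<union> ?N = carrier G"
    using MG g finite_carrier by (intro card_subset_eq) auto
  then obtain m where "m \<in> M" "h = inv g \<otimes> m"
    using h by auto
  then show ?thesis
    using g MG by (auto simp: m_assoc[symmetric])
qed

text \<open>The virtual \<open>G\<close>-set \<open>1 - [G/M]\<close>, for \<open>M\<close> of index 2.\<close>

lemma burnside_index_two:
  assumes M: "subgroup M G" and index: "2 * card M = order G"
  obtains a where "a \<in> carrier (burnside_ring G)"
    "\<And>H. subgroup H G \<Longrightarrow> burnside_mark a H = (if H \<subseteq> M then -1 else 1)"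
proof -
  interpret M: subgroup M G by fact
  \<comment> \<open>A model of the two cosets of \<open>M\<close>: elements of \<open>M\<close> act
    trivially, all others swap 0 and 1.\<close>
  define X :: "'a gset" where "X = ({0, 1}, \<lambda>g. \<lambda>n \<in> {0, 1}. if g \<in> M then n else 1 - n)"
  have iff: "g \<otimes> h \<in> M \<longleftrightarrow> (g \<in> M \<longleftrightarrow> h \<in> M)" if "g \<in> carrier G" "h \<in> carrier G" for g h
  proof -
    have "h \<in> M" if "g \<in> M" "g \<otimes> h \<in> M"
    proof -
      have "inv g \<otimes> (g \<otimes> h) \<in> M" using that by simp
      then show ?thesis
        using \<open>g \<in> carrier G\<close> \<open>h \<in> carrier G\<close> by (simp add: m_assoc[symmetric])
    qed
    moreover have "g \<in> M" if "h \<in> M" "g \<otimes> h \<in> M"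
    proof -
      have "g \<otimes> h \<otimes> inv h \<in> M" using that by simp
      then show ?thesis
        using \<open>g \<in> carrier G\<close> \<open>h \<in> carrier G\<close> by (simp add: m_assoc)
    qed
    ultimately show ?thesis
      using index_two_mult_mem[OF M index] that by blast
  qed
  have X: "X \<in> fin_gsets G"
    unfolding X_def by (rule fin_gsetsI) (auto simp: iff)
  then have u: "(gset_point, X) \<in> fin_gsets G \<times> fin_gsets G"
    using gset_point_closed by simp
  have "burnside_mark (burnside_class (gset_point, X)) H = (if H \<subseteq> M then -1 else 1)"
    if H: "subgroup H G" for H
  proof -
    \<comment> \<open>A single element of \<open>H\<close> outside \<open>M\<close> already moves
      both points. The mark of the virtual set is therefore 1 - 2 or 1 - 0.\<close>
    have "gset_fixed X H = (if H \<subseteq> M then {0, 1} else {})"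
      by (auto simp: gset_fixed_def X_def)
    then show ?thesis
      using burnside_mark_class[OF u H] by (simp add: virtual_mark_def gset_fixed_point)
  qed
  then show ?thesis
    using that burnside_class_closed[OF u] by blast
qed

text \<open>These products supply units with prescribed signs at subgroups of index 2.\<close>

lemma burnside_prod_index_two:
  assumes "finite A" "\<And>M. M \<in> A \<Longrightarrow> subgroup M G \<and> 2 * card M = order G"
  shows "\<exists>a\<in>carrier (burnside_ring G). \<forall>H. subgroup H G \<longrightarrow>
           burnside_mark a H = (\<Prod>M\<in>A. if H \<subseteq> M then -1 else 1)"
  using assms
proof (induction A)
  case empty
  then show ?case
    using burnside_one_closed burnside_mark_one by auto
next
  case (insert M A)
  then obtain a where a: "a \<in> carrier (burnside_ring G)"
    "\<And>H. subgroup H G \<Longrightarrow> burnside_mark a H = (\<Prod>M\<in>A. if H \<subseteq> M then -1 else 1)"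
    by auto
  obtain b where b: "b \<in> carrier (burnside_ring G)"
    "\<And>H. subgroup H G \<Longrightarrow> burnside_mark b H = (if H \<subseteq> M then -1 else 1)"
    using burnside_index_two insert.prems by blast
  show ?case
    using insert.hyps a b
    by (intro bexI[of _ "b \<otimes>\<^bsub>burnside_ring G\<^esub> a"]) (simp_all add: burnside_mark_mult burnside_mult_closed)
qed

end

section \<open>Maximal subgroups and index 2\<close>

text \<open>Some \<open>g\<close> outside \<open>M\<close> has its square in \<open>M\<close>. Then
  \<open>M\<close> and its coset by \<open>g\<close> together form a subgroup strictly above
  \<open>M\<close>, which by maximality is everything.\<close>

lemma (in comm_group) index_two_of_maximal:
  assumes fin: "finite (carrier G)" and order: "order G = 2 ^ n" and M: "M \<in> maximal_subgroups G"
  shows "2 * card M = order G"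
proof -
  have sub: "subgroup M G" and ne: "M \<noteq> carrier G"
    and max: "\<forall>K. subgroup K G \<and> M \<subseteq> K \<longrightarrow> K = M \<or> K = carrier G"
    using M by (simp_all add: maximal_subgroups_def)
  interpret M: subgroup M G by fact
  obtain x where x: "x \<in> carrier G" "x \<notin> M"
    using ne M.subset by blast
  have "x [^] (2 ^ n :: nat) \<in> M"
    using pow_order_eq_1[OF x(1)] order by simp
  \<comment> \<open>Repeated squaring of \<open>x\<close> reaches the identity, hence enters
    \<open>M\<close>. The last iterate still outside \<open>M\<close> is the required
    \<open>g\<close>; it exists because \<open>x\<close> itself is outside, so \<open>i\<close> is
    not 0.\<close>
  define i where "i = (LEAST i. x [^] (2 ^ i :: nat) \<in> M)"
  have i: "x [^] (2 ^ i :: nat) \<in> M"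
    unfolding i_def using \<open>x [^] (2 ^ n :: nat) \<in> M\<close> by (rule LeastI)
  then obtain j where j: "i = Suc j"
    using x by (cases i) auto
  define g where "g = x [^] (2 ^ j :: nat)"
  have gG: "g \<in> carrier G" using x by (simp add: g_def)
  have gM: "g \<notin> M"
    using not_less_Least[of j "\<lambda>i. x [^] (2 ^ i :: nat) \<in> M"] j unfolding i_def g_def by simp
  have "g \<otimes> g = x [^] (2 ^ i :: nat)"
    using x by (simp add: g_def j nat_pow_mult mult_2)
  then have gg: "g \<otimes> g \<in> M" using i by simp
  let ?N = "(\<lambda>m. g \<otimes> m) ` M"
  have "subgroup (M \<union> ?N) G"
  proof (rule subgroupI)
    show "M \<union> ?N \<subseteq> carrier G" using gG by auto
    show "M \<union> ?N \<noteq> {}" using M.one_closed by blast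
  next
    fix a assume "a \<in> M \<union> ?N"
    then show "inv a \<in> M \<union> ?N"
    proof
      assume "a \<in> ?N"
      then obtain m where m: "m \<in> M" "a = g \<otimes> m" by auto
      have "inv a = g \<otimes> (inv (g \<otimes> g) \<otimes> inv m)"
      proof -
        have mG: "m \<in> carrier G" using m by simp
        have "g \<otimes> (inv (g \<otimes> g) \<otimes> inv m) = g \<otimes> inv g \<otimes> (inv g \<otimes> inv m)"
          using mG gG by (simp add: inv_mult m_assoc[symmetric])
        also have "\<dots> = inv a"
          using mG gG m(2) by (simp add: inv_mult)
        finally show ?thesis by simp
      qed
      then show ?thesis using gg m(1) by auto
    qed simp
  next
    fix a b assume "a \<in> M \<union> ?N" "b \<in> M \<union> ?N"
    then consider "a \<in> M" "b \<in> M" | m where "m \<in> M" "a = g \<otimes> m" "b \<in> M"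
      | m where "a \<in> M" "m \<in> M" "b = g \<otimes> m"
      | m m' where "m \<in> M" "m' \<in> M" "a = g \<otimes> m" "b = g \<otimes> m'"
      by auto
    then show "a \<otimes> b \<in> M \<union> ?N"
    proof cases
      case 2
      then have "a \<otimes> b = g \<otimes> (m \<otimes> b)" using gG by (simp add: m_assoc)
      then show ?thesis using 2 by auto
    next
      case 3
      then have "a \<otimes> b = g \<otimes> (a \<otimes> m)" using gG by (simp add: m_lcomm)
      then show ?thesis using 3 by auto
    next
      case 4
      then have "a \<otimes> b = g \<otimes> g \<otimes> (m \<otimes> m')" using gG by (simp add: m_ac)
      then show ?thesis using 4 gg by auto
    qed simp
  qed
  moreover have "g \<in> ?N"
    using gG by (auto intro!: image_eqI[where x = \<one>])
  ultimately have un: "M \<union> ?N = carrier G"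
    using max gM by (metis Un_upper1 UnI2)
  have "M \<inter> ?N = {}"
  proof -
    have False if m: "m \<in> M" "g \<otimes> m \<in> M" for m
    proof -
      have "g \<otimes> m \<otimes> inv m \<in> M" using m by simp
      then show False using gM gG m(1) by (simp add: m_assoc)
    qed
    then show ?thesis by auto
  qed
  moreover have "finite M" using fin M.subset finite_subset by blast
  moreover have "card ?N = card M"
    using gG M.subset by (intro card_image inj_on_subset[OF inj_on_cmult]) auto
  ultimately show ?thesis
    using un card_Un_disjoint[of M ?N] by (simp add: order_def)
qed

text \<open>A subgroup above \<open>M\<close> contains at least half the group, so its index is 1 or
  2, and in the latter case it equals \<open>M\<close> by cardinality.\<close>

lemma (in finite_group) maximal_of_index_two:
  assumes M: "subgroup M G" and index: "2 * card M = order G"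
  shows "M \<in> maximal_subgroups G"
proof -
  have MG: "M \<subseteq> carrier G" using M subgroup.subset by blast
  have pos: "0 < order G" using finite_carrier order_gt_0_iff_finite by blast
  have "K = M \<or> K = carrier G" if K: "subgroup K G" "M \<subseteq> K" for K
  proof -
    have KG: "K \<subseteq> carrier G" using K subgroup.subset by blast
    have fin: "finite K" using KG finite_carrier finite_subset by blast
    have "card M \<le> card K" using fin K(2) by (rule card_mono)
    from K(1) show ?thesis
    proof (cases rule: card_subgroup_cases)
      case 2
      then show ?thesis using card_subset_eq[OF fin K(2)] index by simp
    next
      case 3
      then show ?thesis using \<open>card M \<le> card K\<close> index by simp
    qed simp
  qed
  moreover have "M \<noteq> carrier G"
    using index pos by (auto simp: order_def)
  ultimately show ?thesis
    using M by (auto simp: maximal_subgroups_def)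
qed

section \<open>Vector spaces over finite fields\<close>

text \<open>Coordinates with respect to a basis identify the space with the functions from the basis
  to the field. This lets the dimension be read off a count.\<close>

lemma (in vectorspace) card_carrier_eq:
  assumes "finite (carrier V)"
  shows "fin_dim" "card (carrier V) = card (carrier K) ^ dim"
proof -
  have "span (carrier V) = carrier V"
    using in_own_span[of "carrier V"] span_is_subset2[of "carrier V"] by auto
  then show fd: fin_dim
    using assms unfolding fin_dim_def by blast
  then obtain A where A: "finite A" "basis A"
    using finite_basis_exists by blast
  then have AV: "A \<subseteq> carrier V" by (simp add: basis_def)
  have unique: "\<exists>!a. a \<in> A \<rightarrow>\<^sub>E carrier K \<and> lincomb a A = v" if "v \<in> carrier V" for v
    using basis_criterion[OF A(1) AV] A(2) that by blast
  have closed: "lincomb a A \<in> carrier V" if "a \<in> A \<rightarrow>\<^sub>E carrier K" for a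
    using AV that by (intro lincomb_closed) auto
  have "bij_betw (\<lambda>a. lincomb a A) (A \<rightarrow>\<^sub>E carrier K) (carrier V)"
    unfolding bij_betw_def
  proof
    show "inj_on (\<lambda>a. lincomb a A) (A \<rightarrow>\<^sub>E carrier K)"
      using unique closed unfolding inj_on_def by metis
    show "(\<lambda>a. lincomb a A) ` (A \<rightarrow>\<^sub>E carrier K) = carrier V"
      using unique closed by blast
  qed
  then have "card (carrier V) = card (A \<rightarrow>\<^sub>E carrier K)"
    using bij_betw_same_card by metis
  then show "card (carrier V) = card (carrier K) ^ dim"
    using A dim_basis by (simp add: card_funcsetE)
qed

text \<open>Trivial squares make every vector its own negative and make the scalar law for 1 + 1 = 0
  hold.\<close>

lemma F2_space_vectorspace:
  fixes U (structure)
  assumes "comm_group U" and square: "\<And>x. x \<in> carrier U \<Longrightarrow> x \<otimes> x = \<one>"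
  shows "vectorspace (residue_ring 2) (F2_space U)"
proof -
  interpret U: comm_group U by fact
  have K: "carrier (residue_ring 2) = {0, 1}"
    by (auto simp: residue_ring_def)
  show ?thesis
  proof (rule vs_criteria)
    show "field (residue_ring 2)"
      using residues_prime.is_field[of 2] by (simp add: residues_prime_def)
    show "\<forall>v\<in>carrier (F2_space U). \<exists>w\<in>carrier (F2_space U).
        v \<oplus>\<^bsub>F2_space U\<^esub> w = \<zero>\<^bsub>F2_space U\<^esub>"
      using square by (auto simp: F2_space_def)
  qed (auto simp: F2_space_def residue_ring_def K[unfolded residue_ring_def, simplified] U.m_ac square)
qed

section \<open>Fusion systems and their Burnside rings\<close>

context fusion_system
begin

sublocale finite_group S
  by unfold_locales (rule finite_carrier)

text \<open>Replaces equalities of extensional composites by pointwise ones.\<close>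

lemma fusion_iso_iff:
  "\<phi> \<in> fusion_iso F P Q \<longleftrightarrow>
     \<phi> \<in> F P Q \<and> (\<exists>\<psi>\<in>F Q P. (\<forall>x\<in>P. \<psi> (\<phi> x) = x) \<and> (\<forall>y\<in>Q. \<phi> (\<psi> y) = y))"
proof -
  have "compose A g f = (\<lambda>x\<in>A. x) \<longleftrightarrow> (\<forall>x\<in>A. g (f x) = x)" for A and f g :: "'a \<Rightarrow> 'a"
    by (auto simp: compose_def restrict_def fun_eq_iff)
  then show ?thesis
    by (simp add: fusion_iso_def)
qed

lemma morphism_closed:
  assumes "subgroup P S" "subgroup Q S" "\<phi> \<in> F P Q" "x \<in> P"
  shows "\<phi> x \<in> Q"
  using morphism_hom[OF assms(1-3)] assms(4) by (auto simp: hom_def)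

lemma fusion_iso_bij:
  assumes "subgroup P S" "subgroup Q S" "\<phi> \<in> fusion_iso F P Q"
  shows "bij_betw \<phi> P Q"
proof -
  obtain \<psi> where "\<phi> \<in> F P Q" "\<psi> \<in> F Q P" "\<forall>x\<in>P. \<psi> (\<phi> x) = x" "\<forall>y\<in>Q. \<phi> (\<psi> y) = y"
    using assms(3) by (auto simp: fusion_iso_iff)
  then show ?thesis
    using morphism_closed assms(1,2) by (intro bij_betwI[where g = \<psi>]) auto
qed

lemma identity_morphism:
  assumes "subgroup P S" "subgroup Q S" "P \<subseteq> Q"
  shows "(\<lambda>x\<in>P. x) \<in> F P Q"
proof -
  have PS: "x \<in> carrier S" if "x \<in> P" for x
    using assms(1) that subgroup.mem_carrier by metis
  have "(\<lambda>x\<in>P. x) = (\<lambda>x\<in>P. \<one> \<otimes> x \<otimes> inv \<one>)"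
    using PS by (auto simp: fun_eq_iff)
  then have "(\<lambda>x\<in>P. x) \<in> conj_hom S P Q"
    unfolding conj_hom_def using PS assms(3) by (auto intro!: exI[of _ \<one>])
  then show ?thesis
    using conj_hom_subset assms by blast
qed

lemma fusion_conj_subgroup:
  "(P, Q) \<in> fusion_conj S F \<Longrightarrow> subgroup P S" "(P, Q) \<in> fusion_conj S F \<Longrightarrow> subgroup Q S"
  by (auto simp: fusion_conj_def)

lemma fusion_conjE:
  assumes "(P, Q) \<in> fusion_conj S F"
  obtains \<phi> \<psi> where "\<phi> \<in> F P Q" "\<psi> \<in> F Q P" "\<And>x. x \<in> P \<Longrightarrow> \<psi> (\<phi> x) = x" "\<And>y. y \<in> Q \<Longrightarrow> \<phi> (\<psi> y) = y"
proof -
  obtain \<phi> where "\<phi> \<in> fusion_iso F P Q"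
    using assms by (auto simp: fusion_conj_def)
  then show ?thesis
    using that unfolding fusion_iso_iff by blast
qed

lemma fusion_conjI:
  assumes "subgroup P S" "subgroup Q S" "\<phi> \<in> F P Q" "\<psi> \<in> F Q P"
    "\<And>x. x \<in> P \<Longrightarrow> \<psi> (\<phi> x) = x" "\<And>y. y \<in> Q \<Longrightarrow> \<phi> (\<psi> y) = y"
  shows "(P, Q) \<in> fusion_conj S F"
proof -
  have "\<phi> \<in> fusion_iso F P Q"
    unfolding fusion_iso_iff using assms(3-) by blast
  then show ?thesis
    using assms(1,2) by (auto simp: fusion_conj_def)
qed

lemma fusion_conj_card:
  assumes "(P, Q) \<in> fusion_conj S F"
  shows "card P = card Q"
proof -
  obtain \<phi> where "\<phi> \<in> fusion_iso F P Q"
    using assms by (auto simp: fusion_conj_def)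
  then show ?thesis
    using fusion_iso_bij fusion_conj_subgroup[OF assms] bij_betw_same_card by blast
qed

lemma equiv_fusion_conj: "equiv {H. subgroup H S} (fusion_conj S F)"
proof (rule equivI)
  show "fusion_conj S F \<subseteq> {H. subgroup H S} \<times> {H. subgroup H S}"
    by (auto simp: fusion_conj_def)
  show "refl_on {H. subgroup H S} (fusion_conj S F)"
  proof (rule refl_onI)
    fix P assume "P \<in> {H. subgroup H S}"
    then show "(P, P) \<in> fusion_conj S F"
      by (intro fusion_conjI[where \<phi> = "\<lambda>x\<in>P. x" and \<psi> = "\<lambda>x\<in>P. x"]) (auto intro: identity_morphism)
  qed
  show "sym (fusion_conj S F)"
  proof (rule symI)
    fix P Q assume PQ: "(P, Q) \<in> fusion_conj S F"
    then show "(Q, P) \<in> fusion_conj S F"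
      using fusion_conj_subgroup[OF PQ] by (metis fusion_conjE fusion_conjI)
  qed
  show "trans (fusion_conj S F)"
  proof (rule transI)
    fix P Q R assume PQ: "(P, Q) \<in> fusion_conj S F" and QR: "(Q, R) \<in> fusion_conj S F"
    note sub = fusion_conj_subgroup[OF PQ] fusion_conj_subgroup(2)[OF QR]
    obtain \<phi> \<psi> where 1: "\<phi> \<in> F P Q" "\<psi> \<in> F Q P"
      "\<And>x. x \<in> P \<Longrightarrow> \<psi> (\<phi> x) = x" "\<And>y. y \<in> Q \<Longrightarrow> \<phi> (\<psi> y) = y"
      using PQ by (rule fusion_conjE) blast
    obtain \<phi>' \<psi>' where 2: "\<phi>' \<in> F Q R" "\<psi>' \<in> F R Q"
      "\<And>x. x \<in> Q \<Longrightarrow> \<psi>' (\<phi>' x) = x" "\<And>y. y \<in> R \<Longrightarrow> \<phi>' (\<psi>' y) = y"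
      using QR by (rule fusion_conjE) blast
    have closed: "\<phi> x \<in> Q" "\<phi>' (\<phi> x) \<in> R" if "x \<in> P" for x
      using morphism_closed sub 1(1) 2(1) that by blast+
    have closed': "\<psi>' x \<in> Q" "\<psi> (\<psi>' x) \<in> P" if "x \<in> R" for x
      using morphism_closed sub 1(2) 2(2) that by blast+
    show "(P, R) \<in> fusion_conj S F"
    proof (rule fusion_conjI)
      show "compose P \<phi>' \<phi> \<in> F P R"
        using morphism_compose[OF sub 1(1) 2(1)] .
      show "compose R \<psi> \<psi>' \<in> F R P"
        using morphism_compose[OF sub(3,2,1) 2(2) 1(2)] .
    qed (use sub 1(3,4) 2(3,4) closed closed' in \<open>simp_all add: compose_eq\<close>)
  qed
qed

lemma automorphism_bij:
  assumes "\<alpha> \<in> F (carrier S) (carrier S)"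
  shows "bij_betw \<alpha> (carrier S) (carrier S)"
proof -
  have "inj_on \<alpha> (carrier S)" "\<alpha> ` carrier S \<subseteq> carrier S"
    using morphism_hom[OF subgroup_self subgroup_self assms] by (auto simp: hom_def)
  then show ?thesis
    using endo_inj_surj[OF finite_carrier] by (simp add: bij_betw_def)
qed

text \<open>Restrict \<alpha> to \<open>P\<close> by composing with the inclusion, then factor the
  result as an isomorphism followed by an inclusion. The isomorphism has the same values as
  \<alpha>, so its target is the image of \<open>P\<close>.\<close>

lemma fusion_conj_image:
  assumes \<alpha>: "\<alpha> \<in> F (carrier S) (carrier S)" and P: "subgroup P S"
  shows "(P, \<alpha> ` P) \<in> fusion_conj S F"
proof -
  have PS: "P \<subseteq> carrier S" using P subgroup.subset by blast
  have "compose P \<alpha> (\<lambda>x\<in>P. x) \<in> F P (carrier S)"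
    using morphism_compose[OF P subgroup_self subgroup_self identity_morphism \<alpha>] P PS subgroup_self
    by blast
  then obtain R \<psi> where R: "subgroup R S" "\<psi> \<in> fusion_iso F P R"
    and eq: "compose P \<alpha> (\<lambda>x\<in>P. x) = compose P (\<lambda>x\<in>R. x) \<psi>"
    using morphism_factor[OF P subgroup_self] by blast
  have bij: "bij_betw \<psi> P R"
    using fusion_iso_bij P R by blast
  have "\<alpha> x = \<psi> x" if "x \<in> P" for x
    using fun_cong[OF eq, of x] that bij by (auto simp: compose_def bij_betw_def)
  then have "\<alpha> ` P = R"
    using bij by (auto simp: bij_betw_def)
  then show ?thesis
    using P R by (auto simp: fusion_conj_def)
qed

section \<open>Units of the Burnside ring of a fusion system\<close>

lemma fusion_burnside_simps:
  "monoid.mult (fusion_burnside_ring S F) = monoid.mult (burnside_ring S)"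
  "one (fusion_burnside_ring S F) = one (burnside_ring S)"
  by (simp_all add: fusion_burnside_ring_def)

lemma fusion_burnside_carrier:
  "a \<in> carrier (fusion_burnside_ring S F) \<longleftrightarrow> a \<in> carrier (burnside_ring S) \<and>
     (\<forall>P Q. (P, Q) \<in> fusion_conj S F \<longrightarrow> burnside_mark a P = burnside_mark a Q)"
  by (auto simp: fusion_burnside_ring_def)

lemma fusion_burnside_comm_monoid: "comm_monoid (fusion_burnside_ring S F)"
proof (rule comm_monoidI)
  fix x y
  assume "x \<in> carrier (fusion_burnside_ring S F)" "y \<in> carrier (fusion_burnside_ring S F)"
  then show "x \<otimes>\<^bsub>fusion_burnside_ring S F\<^esub> y \<in> carrier (fusion_burnside_ring S F)"
    by (auto simp: fusion_burnside_carrier fusion_burnside_simps burnside_mult_closed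
        burnside_mark_mult fusion_conj_subgroup)
next
  show "\<one>\<^bsub>fusion_burnside_ring S F\<^esub> \<in> carrier (fusion_burnside_ring S F)"
    by (auto simp: fusion_burnside_carrier fusion_burnside_simps burnside_one_closed
        burnside_mark_one fusion_conj_subgroup)
qed (simp_all only: fusion_burnside_simps fusion_burnside_carrier,
    (rule burnside_eqI; simp add: burnside_mult_closed burnside_mark_mult burnside_one_closed
      burnside_mark_one)+)

text \<open>Marks of a unit are invertible integers. Conversely an element with all marks 1 or -1
  squares to one, so it is its own inverse and no inverse outside the subring has to be
  considered.\<close>

lemma fusion_burnside_Units:
  "a \<in> Units (fusion_burnside_ring S F) \<longleftrightarrow> a \<in> carrier (fusion_burnside_ring S F) \<and>
     (\<forall>H. subgroup H S \<longrightarrow> burnside_mark a H \<in> {1, -1})"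
proof
  assume "a \<in> Units (fusion_burnside_ring S F)"
  then obtain b where a: "a \<in> carrier (fusion_burnside_ring S F)"
    and b: "b \<in> carrier (fusion_burnside_ring S F)"
    and ab: "a \<otimes>\<^bsub>burnside_ring S\<^esub> b = \<one>\<^bsub>burnside_ring S\<^esub>"
    by (auto simp: Units_def fusion_burnside_simps)
  have "burnside_mark a H * burnside_mark b H = 1" if "subgroup H S" for H
    using burnside_mark_mult[of a b H] burnside_mark_one[OF that] a b ab that
    by (simp add: fusion_burnside_carrier)
  then show "a \<in> carrier (fusion_burnside_ring S F) \<and>
     (\<forall>H. subgroup H S \<longrightarrow> burnside_mark a H \<in> {1, -1})"
    using a zmult_eq_1_iff by blast
next
  assume a: "a \<in> carrier (fusion_burnside_ring S F) \<and>
     (\<forall>H. subgroup H S \<longrightarrow> burnside_mark a H \<in> {1, -1})"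
  then have "burnside_mark a H * burnside_mark a H = 1" if "subgroup H S" for H
    using that by force
  then have "a \<otimes>\<^bsub>burnside_ring S\<^esub> a = \<one>\<^bsub>burnside_ring S\<^esub>"
    using a by (intro burnside_eqI)
      (auto simp: fusion_burnside_carrier burnside_mult_closed burnside_mark_mult burnside_one_closed
        burnside_mark_one)
  then show "a \<in> Units (fusion_burnside_ring S F)"
    using a by (auto simp: Units_def fusion_burnside_simps)
qed

lemma fusion_burnside_unit_square:
  assumes "a \<in> Units (fusion_burnside_ring S F)"
  shows "a \<otimes>\<^bsub>burnside_ring S\<^esub> a = \<one>\<^bsub>burnside_ring S\<^esub>"
proof (rule burnside_eqI)
  have a: "a \<in> carrier (burnside_ring S)"
    using assms by (simp add: fusion_burnside_Units fusion_burnside_carrier)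
  then show "a \<otimes>\<^bsub>burnside_ring S\<^esub> a \<in> carrier (burnside_ring S)"
    by (simp add: burnside_mult_closed)
  show "\<one>\<^bsub>burnside_ring S\<^esub> \<in> carrier (burnside_ring S)"
    by (rule burnside_one_closed)
  fix H assume "subgroup H S"
  then show "burnside_mark (a \<otimes>\<^bsub>burnside_ring S\<^esub> a) H = burnside_mark \<one>\<^bsub>burnside_ring S\<^esub> H"
    using a assms by (auto simp: fusion_burnside_Units burnside_mark_mult burnside_mark_one)
qed

lemma fusion_burnside_units_vectorspace:
  "vectorspace (residue_ring 2) (fusion_burnside_units S F)"
  unfolding fusion_burnside_units_def
proof (rule F2_space_vectorspace)
  show "comm_group (units_of (fusion_burnside_ring S F))"
    using fusion_burnside_comm_monoid by (rule comm_monoid.units_comm_group)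
qed (simp add: units_of_def fusion_burnside_simps fusion_burnside_unit_square)

end

section \<open>Fusion in an abelian group comes from automorphisms of the whole group\<close>

locale abelian_saturated_fusion_system = saturated_fusion_system p S F + comm_group S
  for p and S (structure) and F
begin

text \<open>Conjugation is trivial, so the normalizer of \<open>P\<close> and the extension domain
  are all of \<open>S\<close>, and receptivity extends \<phi> to \<open>S\<close>. The extension is
  injective on a finite group, so its target is again \<open>S\<close>.\<close>

lemma fusion_iso_extends:
  assumes P: "subgroup P S" and Q: "subgroup Q S" and rec: "receptive S F Q"
    and \<phi>: "\<phi> \<in> fusion_iso F P Q"
  obtains \<alpha> where "\<alpha> \<in> F (carrier S) (carrier S)" "\<And>x. x \<in> P \<Longrightarrow> \<alpha> x = \<phi> x"
proof -
  have PS: "P \<subseteq> carrier S" and QS: "Q \<subseteq> carrier S"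
    using P Q subgroup.subset by blast+
  have conj: "g \<otimes> x \<otimes> inv g = x" if "g \<in> carrier S" "x \<in> carrier S" for g x
    using that m_comm[of g x] by (simp add: m_assoc)
  have "g <# P #> inv g = P" if "g \<in> carrier S" for g
  proof -
    have "g <# P #> inv g = (\<lambda>x. g \<otimes> x \<otimes> inv g) ` P"
      by (auto simp: l_coset_def r_coset_def)
    also have "\<dots> = (\<lambda>x. x) ` P"
      using PS conj[OF that] by (intro image_cong) auto
    finally show ?thesis by simp
  qed
  then have norm: "normalizer S P = carrier S"
    using PS by (auto simp: normalizer_def stabilizer_def)
  have bij: "bij_betw \<phi> P Q"
    using fusion_iso_bij P Q \<phi> by blast
  have inv: "inv_into P \<phi> y \<in> P" "\<phi> (inv_into P \<phi> y) = y" if "y \<in> Q" for y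
    using that bij by (auto simp: bij_betw_def inv_into_into f_inv_into_f)
  \<comment> \<open>The conjugate by \<phi> of a trivial map is the identity of \<open>Q\<close>,
    which is conjugation by \<open>\<one>\<close>.\<close>
  have "(\<lambda>y\<in>Q. \<phi> (g \<otimes> inv_into P \<phi> y \<otimes> inv g)) = (\<lambda>y\<in>Q. \<one> \<otimes> y \<otimes> inv \<one>)"
    if "g \<in> carrier S" for g
    using inv PS QS that conj by (intro restrict_ext) (auto simp: subset_iff)
  then have "extension_domain S P Q \<phi> = carrier S"
    unfolding extension_domain_def norm conj_hom_def
    using QS by (auto simp: subset_iff intro!: exI[of _ \<one>])
  then obtain R \<psi> where R: "subgroup R S" and \<psi>: "\<psi> \<in> F (carrier S) R" "\<forall>x\<in>P. \<psi> x = \<phi> x"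
    using rec P \<phi> unfolding receptive_def by metis
  have RS: "R \<subseteq> carrier S" using R subgroup.subset by blast
  have "inj_on \<psi> (carrier S)" "\<psi> ` carrier S \<subseteq> R"
    using morphism_hom[OF subgroup_self R \<psi>(1)] by (auto simp: hom_def)
  then have "R = carrier S"
    using RS finite_carrier endo_inj_surj[of "carrier S" \<psi>] by blast
  then show ?thesis
    using that \<psi> by blast
qed

text \<open>Extension is available for isomorphisms onto a receptive subgroup, and saturation
  provides one such \<open>R\<close> in the class. So both \<open>P\<close> and \<open>Q\<close> are
  carried to \<open>R\<close> rather than one to the other.\<close>

lemma fusion_conj_common_image:
  assumes "(P, Q) \<in> fusion_conj S F"
  obtains \<alpha> \<beta> where "\<alpha> \<in> F (carrier S) (carrier S)" "\<beta> \<in> F (carrier S) (carrier S)" "\<alpha> ` P = \<beta> ` Q"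
proof -
  note sub = fusion_conj_subgroup[OF assms]
  obtain R where QR: "(Q, R) \<in> fusion_conj S F" and rec: "receptive S F R"
    using saturated[OF sub(2)] by blast
  have PR: "(P, R) \<in> fusion_conj S F"
    using equiv_fusion_conj assms QR by (meson equivE transD)
  have R: "subgroup R S" using fusion_conj_subgroup QR by blast
  have ex: "\<exists>\<alpha>\<in>F (carrier S) (carrier S). \<alpha> ` P = R" if PR: "(P, R) \<in> fusion_conj S F" for P
  proof -
    have P: "subgroup P S" using fusion_conj_subgroup PR by blast
    obtain \<phi> where \<phi>: "\<phi> \<in> fusion_iso F P R"
      using PR by (auto simp: fusion_conj_def)
    obtain \<alpha> where \<alpha>: "\<alpha> \<in> F (carrier S) (carrier S)" "\<And>x. x \<in> P \<Longrightarrow> \<alpha> x = \<phi> x"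
      using fusion_iso_extends[OF P R rec \<phi>] by blast
    moreover have "\<phi> ` P = R"
      using fusion_iso_bij[OF P R \<phi>] by (simp add: bij_betw_def)
    ultimately show ?thesis by force
  qed
  then show ?thesis
    using that PR QR by metis
qed

text \<open>An automorphism in \<open>F\<close> maps \<open>A\<close> injectively into itself, hence
  permutes it, and it preserves and reflects inclusions. Reindexing the product shows that
  \<open>P\<close> may be replaced by its image; a common image of \<open>P\<close> and
  \<open>Q\<close> then links the two products.\<close>

lemma prod_conj_invariant:
  fixes A :: "'a set set"
  assumes fin: "finite A" and sub: "\<And>M. M \<in> A \<Longrightarrow> subgroup M S"
    and closed: "\<And>M N. M \<in> A \<Longrightarrow> (M, N) \<in> fusion_conj S F \<Longrightarrow> N \<in> A"
    and PQ: "(P, Q) \<in> fusion_conj S F"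
  shows "(\<Prod>M\<in>A. if P \<subseteq> M then -1 else 1 :: int) = (\<Prod>M\<in>A. if Q \<subseteq> M then -1 else 1)"
proof -
  have image: "(\<Prod>M\<in>A. if \<alpha> ` P \<subseteq> M then -1 else 1 :: int) = (\<Prod>M\<in>A. if P \<subseteq> M then -1 else 1)"
    if \<alpha>: "\<alpha> \<in> F (carrier S) (carrier S)" and P: "subgroup P S" for \<alpha> P
  proof -
    have inj: "inj_on \<alpha> (carrier S)"
      using automorphism_bij[OF \<alpha>] by (simp add: bij_betw_def)
    have MS: "M \<subseteq> carrier S" if "M \<in> A" for M
      using sub[OF that] subgroup.subset by blast
    have PS: "P \<subseteq> carrier S" using P subgroup.subset by blast
    have injA: "inj_on (image \<alpha>) A"
      using inj_on_image_eq_iff[OF inj] MS by (auto simp: inj_on_def)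
    have "image \<alpha> ` A \<subseteq> A"
      using closed fusion_conj_image[OF \<alpha>] sub by auto
    then have A: "image \<alpha> ` A = A"
      using endo_inj_surj[OF fin _ injA] by blast
    have "(\<Prod>M\<in>A. if \<alpha> ` P \<subseteq> M then -1 else 1 :: int) =
        (\<Prod>M\<in>image \<alpha> ` A. if \<alpha> ` P \<subseteq> M then -1 else 1)"
      by (simp only: A)
    also have "\<dots> = (\<Prod>M\<in>A. if \<alpha> ` P \<subseteq> \<alpha> ` M then -1 else 1)"
      using injA by (simp add: prod.reindex)
    also have "\<dots> = (\<Prod>M\<in>A. if P \<subseteq> M then -1 else 1)"
    proof (intro prod.cong if_cong refl)
      fix M assume "M \<in> A"
      then show "\<alpha> ` P \<subseteq> \<alpha> ` M \<longleftrightarrow> P \<subseteq> M"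
        unfolding image_subset_iff using inj_on_image_mem_iff[OF inj _ MS] PS by blast
    qed
    finally show ?thesis .
  qed
  obtain \<alpha> \<beta> where "\<alpha> \<in> F (carrier S) (carrier S)" "\<beta> \<in> F (carrier S) (carrier S)" "\<alpha> ` P = \<beta> ` Q"
    using PQ by (rule fusion_conj_common_image)
  then show ?thesis
    using image[of \<alpha> P] image[of \<beta> Q] fusion_conj_subgroup[OF PQ] by simp
qed

end

section \<open>Counting the units\<close>

lemma prod_sign_values:
  "(\<Prod>M\<in>A. if P M then -1 else 1 :: int) \<in> {1, -1}"
  by (induction A rule: infinite_finite_induct) auto

locale abelian_saturated_fusion_system_2 = abelian_saturated_fusion_system 2 S F
  for S (structure) and F
begin

lemma maximal_subgroups_eq: "maximal_subgroups S = {M. subgroup M S \<and> 2 * card M = order S}"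
proof -
  obtain n where n: "order S = 2 ^ n" using p_group by blast
  have "subgroup M S \<and> 2 * card M = order S" if "M \<in> maximal_subgroups S" for M
    using index_two_of_maximal[OF finite_carrier n that] that by (simp add: maximal_subgroups_def)
  then show ?thesis
    using maximal_of_index_two by blast
qed

text \<open>A unit is encoded by the set of classes on which its mark is -1, and every set of
  classes arises.\<close>

lemma fusion_burnside_units_card:
  "card (Units (fusion_burnside_ring S F)) = 2 ^ (card (maximal_subgroups S // fusion_conj S F) + 1)"
proof -
  let ?U = "Units (fusion_burnside_ring S F)" and ?m = "burnside_mark"
  define Cl where "Cl = maximal_subgroups S // fusion_conj S F"
  \<comment> \<open>The extra member \<open>{carrier S}\<close> records the mark at
    \<open>S\<close>. It is not in \<open>Cl\<close>, as \<open>S\<close> is not maximal in itself;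
    this is the source of the summand 1.\<close>
  define Cl' where "Cl' = insert {carrier S} Cl"
  define \<Phi> where "\<Phi> a = {C \<in> Cl'. \<forall>M\<in>C. ?m a M = -1}" for a
  have in_Cl: "fusion_conj S F `` {M} \<in> Cl \<and> M \<in> fusion_conj S F `` {M}"
    if "M \<in> maximal_subgroups S" for M
    using that equiv_class_self[OF equiv_fusion_conj]
    by (auto simp: Cl_def quotientI maximal_subgroups_eq)
  have Cl_maximal: "M \<in> maximal_subgroups S" if "C \<in> Cl" "M \<in> C" for C M
    using that fusion_conj_card fusion_conj_subgroup
    by (auto simp: Cl_def quotient_def maximal_subgroups_eq)
  have Cl_class: "fusion_conj S F `` {M} = C" if C: "C \<in> Cl" "M \<in> C" for C M
  proof -
    obtain N where "N \<in> maximal_subgroups S" "C = fusion_conj S F `` {N}"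
      using C(1) by (auto simp: Cl_def quotient_def)
    then show ?thesis
      using C(2) equiv_class_eq[OF equiv_fusion_conj, of N M] by auto
  qed
  have not_max: "carrier S \<notin> maximal_subgroups S"
    by (simp add: maximal_subgroups_def)
  have nonempty: "C \<noteq> {}" if "C \<in> Cl" for C
    using that in_Cl by (auto simp: Cl_def quotient_def)
  have "{carrier S} \<notin> Cl"
    using Cl_maximal not_max by blast
  moreover have "finite Cl"
  proof -
    have "Cl \<subseteq> Pow (Pow (carrier S))"
      using Cl_maximal subgroup.subset by (fastforce simp: maximal_subgroups_def)
    then show ?thesis
      using finite_carrier finite_subset by blast
  qed
  ultimately have card_Cl': "card (Pow Cl') = 2 ^ (card Cl + 1)"
    by (simp add: Cl'_def card_Pow)
  have U: "a \<in> carrier (burnside_ring S)"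
      "\<And>P Q. (P, Q) \<in> fusion_conj S F \<Longrightarrow> ?m a P = ?m a Q"
      "\<And>H. subgroup H S \<Longrightarrow> ?m a H \<in> {1, -1}" if "a \<in> ?U" for a
    using that unfolding fusion_burnside_Units fusion_burnside_carrier by blast+
  have top_iff: "?m a (carrier S) = -1 \<longleftrightarrow> {carrier S} \<in> \<Phi> a" for a
    by (simp add: \<Phi>_def Cl'_def)
  have maximal_iff: "?m a M = -1 \<longleftrightarrow> fusion_conj S F `` {M} \<in> \<Phi> a"
    if "a \<in> ?U" "M \<in> maximal_subgroups S" for a M
  proof -
    let ?C = "fusion_conj S F `` {M}"
    have C: "?C \<in> Cl'" "M \<in> ?C"
      using in_Cl[OF that(2)] unfolding Cl'_def by blast+
    have same: "?m a N = ?m a M" if "N \<in> ?C" for N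
      using U(2)[OF \<open>a \<in> ?U\<close>, of M N] that by simp
    have "?C \<in> \<Phi> a \<longleftrightarrow> (\<forall>N\<in>?C. ?m a N = -1)"
      unfolding \<Phi>_def using C(1) by (simp only: mem_Collect_eq simp_thms)
    also have "\<dots> \<longleftrightarrow> ?m a M = -1"
      using same C(2) by metis
    finally show ?thesis by simp
  qed
  have "bij_betw \<Phi> ?U (Pow Cl')"
  proof (rule bij_betw_imageI)
    show "inj_on \<Phi> ?U"
    proof (rule inj_onI)
      fix a b assume a: "a \<in> ?U" and b: "b \<in> ?U" and eq: "\<Phi> a = \<Phi> b"
      note Ua = U[OF a] and Ub = U[OF b]
      \<comment> \<open>Two signs agree exactly when their product is 1, so injectivity reduces to
        showing that all marks of the product are 1, where \<open>burnside_mark_determined\<close>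
        applies.\<close>
      have ab: "a \<otimes>\<^bsub>burnside_ring S\<^esub> b \<in> carrier (burnside_ring S)"
        using burnside_mult_closed Ua Ub by blast
      have mult: "?m (a \<otimes>\<^bsub>burnside_ring S\<^esub> b) H = ?m a H * ?m b H" if "subgroup H S" for H
        using burnside_mark_mult Ua(1) Ub(1) that by blast
      have one: "?m (a \<otimes>\<^bsub>burnside_ring S\<^esub> b) H = 1 \<longleftrightarrow> ?m a H = ?m b H" if "subgroup H S" for H
        using mult[OF that] Ua(3)[OF that] Ub(3)[OF that] by auto
      have iff: "?m a H = ?m b H" if "subgroup H S" "?m a H = -1 \<longleftrightarrow> ?m b H = -1" for H
        using Ua(3)[OF that(1)] Ub(3)[OF that(1)] that(2) by auto
      have top: "?m a (carrier S) = ?m b (carrier S)"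
        using iff[OF subgroup_self] eq by (simp add: top_iff)
      have maximal: "?m a M = ?m b M" if "subgroup M S" "2 * card M = order S" for M
        using iff[OF that(1)] maximal_iff[OF a] maximal_iff[OF b] eq that
        by (simp add: maximal_subgroups_eq)
      have "?m (a \<otimes>\<^bsub>burnside_ring S\<^esub> b) H = 1" if "subgroup H S" for H
      proof (rule burnside_mark_determined[OF _ ab _ _ _ that])
        show "comm_group S" by (rule comm_group_axioms)
        show "?m (a \<otimes>\<^bsub>burnside_ring S\<^esub> b) H \<in> {1, -1}" if "subgroup H S" for H
          using mult[OF that] Ua(3)[OF that] Ub(3)[OF that] by auto
        show "?m (a \<otimes>\<^bsub>burnside_ring S\<^esub> b) (carrier S) = 1"
          using one top subgroup_self by blast
        show "?m (a \<otimes>\<^bsub>burnside_ring S\<^esub> b) M = 1" if "subgroup M S" "2 * card M = order S" for M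
          using one maximal that by blast
      qed
      then have "?m a H = ?m b H" if "subgroup H S" for H
        using one that by blast
      then show "a = b"
        using Ua(1) Ub(1) by (rule burnside_eqI[rotated 2])
    qed
    show "\<Phi> ` ?U = Pow Cl'"
    proof (intro equalityI subsetI)
      fix T assume "T \<in> Pow Cl'"
      then have T: "T \<subseteq> Cl'" by simp
      \<comment> \<open>The factor \<open>c\<close> fixes the sign at \<open>S\<close> but also
        multiplies every mark at a maximal subgroup. A class therefore enters \<open>A\<close>
        exactly when its wanted sign differs from the one at \<open>S\<close>.\<close>
      define A where "A = \<Union>{C \<in> Cl. (C \<in> T) \<noteq> ({carrier S} \<in> T)}"
      have A_maximal: "M \<in> maximal_subgroups S" if "M \<in> A" for M
        using that Cl_maximal by (auto simp: A_def)
      have A_iff: "M \<in> A \<longleftrightarrow> (C \<in> T) \<noteq> ({carrier S} \<in> T)" if "C \<in> Cl" "M \<in> C" for C M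
        using that Cl_class by (auto simp: A_def)
      have finA: "finite A"
        using A_maximal finite_carrier subgroup.subset
        by (intro finite_subset[of A "Pow (carrier S)"]) (auto simp: maximal_subgroups_def)
      have A_closed: "N \<in> A" if MN: "M \<in> A" "(M, N) \<in> fusion_conj S F" for M N
      proof -
        obtain C where C: "C \<in> Cl" "M \<in> C" "(C \<in> T) \<noteq> ({carrier S} \<in> T)"
          using MN(1) by (auto simp: A_def)
        then have "N \<in> C"
          using Cl_class MN(2) by blast
        then show ?thesis
          using A_iff C by blast
      qed
      obtain b where b: "b \<in> carrier (burnside_ring S)"
        "\<And>H. subgroup H S \<Longrightarrow> ?m b H = (\<Prod>M\<in>A. if H \<subseteq> M then -1 else 1)"
        using burnside_prod_index_two[OF finA] A_maximal by (auto simp: maximal_subgroups_eq)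
      obtain c where c: "c \<in> carrier (burnside_ring S)"
        "\<And>H. subgroup H S \<Longrightarrow> ?m c H = (if {carrier S} \<in> T then -1 else 1)"
      proof (cases "{carrier S} \<in> T")
        case True
        obtain d where "d \<in> carrier (burnside_ring S)" "\<And>H. subgroup H S \<Longrightarrow> ?m d H = -1"
          using burnside_minus_one by blast
        then show ?thesis using that True by simp
      next
        case False
        then show ?thesis using that[OF burnside_one_closed] burnside_mark_one by simp
      qed
      define a where "a = c \<otimes>\<^bsub>burnside_ring S\<^esub> b"
      have mark_a: "?m a H =
          (if {carrier S} \<in> T then -1 else 1) * (\<Prod>M\<in>A. if H \<subseteq> M then -1 else 1)"
        if "subgroup H S" for H
        using that b c by (simp add: a_def burnside_mark_mult)
      have "?m a P = ?m a Q" if "(P, Q) \<in> fusion_conj S F" for P Q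
      proof -
        have "(\<Prod>M\<in>A. if P \<subseteq> M then -1 else 1 :: int) = (\<Prod>M\<in>A. if Q \<subseteq> M then -1 else 1)"
        proof (rule prod_conj_invariant[OF finA _ _ that])
          show "subgroup M S" if "M \<in> A" for M
            using A_maximal[OF that] by (simp add: maximal_subgroups_def)
        qed (rule A_closed)
        then show ?thesis
          using fusion_conj_subgroup[OF that] by (simp add: mark_a)
      qed
      moreover have "?m a H \<in> {1, -1}" if "subgroup H S" for H
        using prod_sign_values[of "\<lambda>M. H \<subseteq> M" A] that by (auto simp: mark_a)
      ultimately have a: "a \<in> ?U"
        using burnside_mult_closed[OF c(1) b(1)] unfolding fusion_burnside_Units fusion_burnside_carrier a_def
        by blast
      have "(\<Prod>M\<in>A. if carrier S \<subseteq> M then -1 else 1 :: int) = 1"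
      proof (rule prod.neutral, intro ballI)
        fix M assume "M \<in> A"
        then have "subgroup M S" "M \<noteq> carrier S"
          using A_maximal not_max by (auto simp: maximal_subgroups_def)
        then show "(if carrier S \<subseteq> M then -1 else 1 :: int) = 1"
          using subgroup.subset by auto
      qed
      then have top: "?m a (carrier S) = -1 \<longleftrightarrow> {carrier S} \<in> T"
        by (simp add: mark_a[OF subgroup_self])
      have maximal: "?m a M = -1 \<longleftrightarrow> C \<in> T" if C: "C \<in> Cl" "M \<in> C" for C M
      proof -
        have M: "M \<in> maximal_subgroups S" using Cl_maximal C by blast
        \<comment> \<open>Distinct maximal subgroups are incomparable, so only the factor at
          \<open>M\<close> itself can contribute a sign.\<close>
        have "M \<subseteq> N \<longleftrightarrow> N = M" if "N \<in> A" for N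
          using A_maximal[OF that] M unfolding maximal_subgroups_def by blast
        then have "(\<Prod>N\<in>A. if M \<subseteq> N then -1 else 1 :: int) = (\<Prod>N\<in>A. if N = M then -1 else 1)"
          by (intro prod.cong) auto
        also have "\<dots> = (if M \<in> A then -1 else 1)"
          using finA by simp
        finally show ?thesis
          using mark_a[of M] M A_iff[OF C] by (auto simp: maximal_subgroups_def)
      qed
      have "C \<in> \<Phi> a \<longleftrightarrow> C \<in> T" if "C \<in> Cl'" for C
      proof (cases "C = {carrier S}")
        case True
        then show ?thesis using that top by (simp add: \<Phi>_def)
      next
        case False
        then have "C \<in> Cl" using that by (simp add: Cl'_def)
        moreover have "C \<in> \<Phi> a \<longleftrightarrow> (\<forall>M\<in>C. ?m a M = -1)"
          using that by (simp add: \<Phi>_def)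
        \<comment> \<open>Nonemptiness of \<open>C\<close> keeps the condition that every mark on it
          is -1 from holding vacuously.\<close>
        ultimately show ?thesis
          using maximal nonempty by blast
      qed
      then have "\<Phi> a = T"
        using T by (auto simp: \<Phi>_def)
      then show "T \<in> \<Phi> ` ?U"
        using a by blast
    qed (auto simp: \<Phi>_def)
  qed
  then show ?thesis
    using card_Cl' bij_betw_same_card by (metis Cl_def)
qed

end

theorem theorem9p2:
  fixes S :: "('a, 'm) monoid_scheme"
    and F :: "'a set \<Rightarrow> 'a set \<Rightarrow> ('a \<Rightarrow> 'a) set"
  assumes "saturated_fusion_system 2 S F"
    and "comm_group S"
  shows "vectorspace (residue_ring 2) (fusion_burnside_units S F) \<and>
    vectorspace.fin_dim (residue_ring 2) (fusion_burnside_units S F) \<and>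
    vectorspace.dim (residue_ring 2) (fusion_burnside_units S F)
      = card (maximal_subgroups S // fusion_conj S F) + 1"
proof -
  interpret abelian_saturated_fusion_system_2 S F
    using assms by (simp add: abelian_saturated_fusion_system_2_def abelian_saturated_fusion_system_def)
  interpret V: vectorspace "residue_ring 2" "fusion_burnside_units S F"
    by (rule fusion_burnside_units_vectorspace)
  have card: "card (carrier (fusion_burnside_units S F)) =
      2 ^ (card (maximal_subgroups S // fusion_conj S F) + 1)"
    using fusion_burnside_units_card
    by (simp add: fusion_burnside_units_def F2_space_def units_of_def)
  \<comment> \<open>Infinite sets have cardinality 0, so a positive cardinality forces
    finiteness.\<close>
  then have fin: "finite (carrier (fusion_burnside_units S F))"
    by (intro card_ge_0_finite) simp
  have "card (carrier (residue_ring 2)) = 2"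
    by (simp add: residue_ring_def)
  \<comment> \<open>Two counts of the same carrier; comparing exponents gives the dimension.\<close>
  then have "(2::nat) ^ V.dim = 2 ^ (card (maximal_subgroups S // fusion_conj S F) + 1)"
    using V.card_carrier_eq(2)[OF fin] card by simp
  then have "V.dim = card (maximal_subgroups S // fusion_conj S F) + 1"
    by (simp del: power_Suc)
  then show ?thesis
    using V.vectorspace_axioms V.card_carrier_eq(1)[OF fin] by simp
qed

end
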